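(* Let $A$ be a finite abelian group with character group $\widehat A$, let $n\geqslant 2$, and let $\kappa=(\kappa_\chi)_{\chi\in\widehat A}$ be a multiplicity vector. Then $V_\kappa$ has a basis $\{\mathbf e_z\}_{z\in\Omega_\kappa}$ satisfying $$x\cdot\mathbf e_z=\langle z,x\rangle\,\mathbf e_z,\qquad \pi\cdot\mathbf e_z=\mathbf e_{\pi\cdot z}$$ for all $z\in\Omega_\kappa$, $x\in A^n$ and $\pi\in\mathfrak S_n$. Moreover, $$\mathcal P_n(A)\cong\bigoplus_{\kappa}V_\kappa,$$ where the sum is over all $\kappa\in\mathbb Z_{\geqslant 0}^{\widehat A}$ with $\sum_{\chi\in\widehat A}\kappa_\chi=n$.
   Context: $W_n(A)=A\wr\mathfrak S_n=A^n\rtimes\mathfrak S_n$ with multiplication $(g;\pi)(h;\sigma)=(g(\pi\cdot h);\pi\sigma)$, $\pi\cdot g=(g_{\pi^{-1}(1)},\dots,g_{\pi^{-1}(n)})$; $A^n$ and $\mathfrak S_n$ are regarded as subgroups. Representations are finite-dimensional over $\mathbb C$. $\mathcal P_n(A)=\mathrm{Ind}_{\mathfrak S_n}^{W_n(A)}\mathrm{triv}$ is the quasi-regular representation. A multiplicity vector is a family $\kappa=(\kappa_\chi)_{\chi\in\widehat A}$ of non-negative integers with $\sum_\chi\kappa_\chi=n$. $V_\kappa$ is the irreducible representation of $A\wr\mathfrak S_n$ indexed by the multipartition whose $\chi$-component is the one-row partition $(\kappa_\chi)$: $$V_\kappa=\mathrm{Ind}_{\prod_\chi(A\wr\mathfrak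 S_{\kappa_\chi})}^{A\wr\mathfrak S_n}\Bigl(\boxtimes_\chi\chi^{\otimes\kappa_\chi}\Bigr),$$ where on $\chi^{\otimes m}$ the base group $A^m$ acts by $(g_1,\dots,g_m)\mapsto\prod_i\chi(g_i)$ and $\mathfrak S_m$ acts trivially. The multislice of shape $\kappa$ is $\Omega_\kappa=\{z=(\chi_1,\dots,\chi_n)\in\widehat A^n:\ |\{i:\chi_i=\chi\}|=\kappa_\chi\text{ for every }\chi\in\widehat A\}$, on which $\mathfrak S_n$ acts by $\pi\cdot z=(\chi_{\pi^{-1}(1)},\dots,\chi_{\pi^{-1}(n)})$. For $z=(\chi_1,\dots,\chi_n)\in\widehat A^n$ and $x=(x_1,\dots,x_n)\in A^n$, $\langle z,x\rangle=\prod_{i=1}^n\chi_i(x_i)$. *)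

theory Defs
  imports
    Complex_Main
    "HOL-Algebra.Product_Groups"
    "HOL-Combinatorics.Permutations"
    "HOL-Library.Disjoint_Sets"
    "HOL-Library.Function_Algebras"
begin

section \<open>Finite-dimensional complex representations\<close>

text \<open>
  The vector space of a representation is a subspace \<open>rep_space R\<close> of an ambient type on which
  \<open>scal R\<close> is a complex scalar multiplication. Operators are only relevant on \<open>rep_space R\<close>.
\<close>

record ('g, 'v) rep =
  rep_space :: "'v set"
  scal :: "complex \<Rightarrow> 'v \<Rightarrow> 'v"
  act :: "'g \<Rightarrow> 'v \<Rightarrow> 'v"

locale group_rep = group G + vector_space "scal R"
  for G :: "('g, 'm) monoid_scheme" (structure) and R :: "('g, 'v::ab_group_add) rep" +
  assumes subspace_space: "subspace (rep_space R)"
    and finite_dim: "\<exists>E. finite E \<and> span E = rep_space R"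
    and act_closed: "\<lbrakk>g \<in> carrier G; v \<in> rep_space R\<rbrakk> \<Longrightarrow> act R g v \<in> rep_space R"
    and act_add: "\<lbrakk>g \<in> carrier G; v \<in> rep_space R; w \<in> rep_space R\<rbrakk>
      \<Longrightarrow> act R g (v + w) = act R g v + act R g w"
    and act_scal: "\<lbrakk>g \<in> carrier G; v \<in> rep_space R\<rbrakk> \<Longrightarrow> act R g (scal R c v) = scal R c (act R g v)"
    and act_one: "v \<in> rep_space R \<Longrightarrow> act R \<one> v = v"
    and act_mult: "\<lbrakk>g \<in> carrier G; h \<in> carrier G; v \<in> rep_space R\<rbrakk>
      \<Longrightarrow> act R (g \<otimes> h) v = act R g (act R h v)"

definition rep_iso ::
  "('g, 'm) monoid_scheme \<Rightarrow> ('g, 'v::ab_group_add) rep \<Rightarrow> ('g, 'w::ab_group_add) rep \<Rightarrow> bool" where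
  "rep_iso G R S \<longleftrightarrow> group_rep G R \<and> group_rep G S \<and>
    (\<exists>T. bij_betw T (rep_space R) (rep_space S) \<and>
      (\<forall>v\<in>rep_space R. \<forall>w\<in>rep_space R. T (v + w) = T v + T w) \<and>
      (\<forall>c. \<forall>v\<in>rep_space R. T (scal R c v) = scal S c (T v)) \<and>
      (\<forall>g\<in>carrier G. \<forall>v\<in>rep_space R. T (act R g v) = act S g (T v)))"

definition rep_basis :: "('g, 'v::ab_group_add) rep \<Rightarrow> 'z set \<Rightarrow> ('z \<Rightarrow> 'v) \<Rightarrow> bool" where
  "rep_basis R Z e \<longleftrightarrow> inj_on e Z \<and> \<not> module.dependent (scal R) (e ` Z) \<and>
    module.span (scal R) (e ` Z) = rep_space R"

text \<open>A one-dimensional representation on \<open>\<complex>\<close>, given by its scalars.\<close>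

definition scalar_rep :: "('g \<Rightarrow> complex) \<Rightarrow> ('g, complex) rep" where
  "scalar_rep l = \<lparr>rep_space = UNIV, scal = (*), act = (\<lambda>g v. l g * v)\<rparr>"

definition triv_rep :: "('g, complex) rep" where
  "triv_rep = scalar_rep (\<lambda>_. 1)"

text \<open>
  The representation of \<open>G\<close> induced from a representation \<open>U\<close> of the subgroup \<open>H\<close>, in the model of
  functions with \<open>f (x h) = h\<inverse> \<cdot> f x\<close> and \<open>G\<close> acting by left translation,
  \<open>(g \<cdot> f) x = f (g\<inverse> x)\<close>. Functions vanish outside \<open>carrier G\<close>.
\<close>

definition induced_rep ::
  "('g, 'm) monoid_scheme \<Rightarrow> 'g set \<Rightarrow> ('g, 'v::ab_group_add) rep \<Rightarrow> ('g, 'g \<Rightarrow> 'v) rep" where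
  "induced_rep G H U = \<lparr>
    rep_space = {f. (\<forall>x\<in>carrier G. f x \<in> rep_space U) \<and>
                (\<forall>x\<in>carrier G. \<forall>h\<in>H. f (x \<otimes>\<^bsub>G\<^esub> h) = act U (inv\<^bsub>G\<^esub> h) (f x)) \<and>
                (\<forall>x. x \<notin> carrier G \<longrightarrow> f x = 0)},
    scal = (\<lambda>c f x. scal U c (f x)),
    act = (\<lambda>g f x. if x \<in> carrier G then f (inv\<^bsub>G\<^esub> g \<otimes>\<^bsub>G\<^esub> x) else 0)\<rparr>"

text \<open>Used for finite index sets only.\<close>

definition direct_sum_rep ::
  "'k set \<Rightarrow> ('k \<Rightarrow> ('g, 'v::ab_group_add) rep) \<Rightarrow> ('g, 'k \<Rightarrow> 'v) rep" where
  "direct_sum_rep K R = \<lparr>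
    rep_space = {F. (\<forall>k\<in>K. F k \<in> rep_space (R k)) \<and> (\<forall>k. k \<notin> K \<longrightarrow> F k = 0)},
    scal = (\<lambda>c F k. scal (R k) c (F k)),
    act = (\<lambda>g F k. if k \<in> K then act (R k) g (F k) else 0)\<rparr>"

section \<open>Wreath products\<close>

definition perm_act :: "nat set \<Rightarrow> (nat \<Rightarrow> nat) \<Rightarrow> (nat \<Rightarrow> 'b) \<Rightarrow> nat \<Rightarrow> 'b" where
  "perm_act I p z = (\<lambda>i\<in>I. z (Hilbert_Choice.inv p i))"

text \<open>\<open>A \<wr> Sym(I)\<close>; permutations of \<open>I\<close> are functions on \<^typ>\<open>nat\<close> fixing everything outside \<open>I\<close>.\<close>

definition wreath ::
  "('a, 'm) monoid_scheme \<Rightarrow> nat set \<Rightarrow> ((nat \<Rightarrow> 'a) \<times> (nat \<Rightarrow> nat)) monoid" where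
  "wreath A I = \<lparr>
    carrier = carrier (product_group I (\<lambda>_. A)) \<times> {p. p permutes I},
    monoid.mult = (\<lambda>(g, p) (h, q). (g \<otimes>\<^bsub>product_group I (\<lambda>_. A)\<^esub> perm_act I p h, p \<circ> q)),
    one = (\<one>\<^bsub>product_group I (\<lambda>_. A)\<^esub>, id)\<rparr>"

lemma perm_act_perm_act:
  assumes "p permutes I" "q permutes I"
  shows "perm_act I p (perm_act I q z) = perm_act I (p \<circ> q) z"
proof
  fix i
  have "i \<in> I \<Longrightarrow> Hilbert_Choice.inv p i \<in> I"
    using permutes_in_image[OF permutes_inv[OF assms(1)]] by simp
  moreover have "Hilbert_Choice.inv (p \<circ> q) i = Hilbert_Choice.inv q (Hilbert_Choice.inv p i)"
    using o_inv_distrib[OF permutes_bij[OF assms(1)] permutes_bij[OF assms(2)]] by simp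
  ultimately show "perm_act I p (perm_act I q z) i = perm_act I (p \<circ> q) z i"
    by (simp add: perm_act_def)
qed

lemma perm_act_closed:
  assumes "p permutes I" "z \<in> I \<rightarrow>\<^sub>E S"
  shows "perm_act I p z \<in> I \<rightarrow>\<^sub>E S"
  using assms permutes_in_image[OF permutes_inv[OF assms(1)]] by (auto simp: perm_act_def)

lemma perm_act_id: "z \<in> I \<rightarrow>\<^sub>E S \<Longrightarrow> perm_act I id z = z"
  by (auto simp: perm_act_def fun_eq_iff PiE_iff extensional_def)

lemma perm_act_mult:
  assumes "p permutes I"
  shows "perm_act I p (g \<otimes>\<^bsub>product_group I (\<lambda>_. A)\<^esub> h) =
    perm_act I p g \<otimes>\<^bsub>product_group I (\<lambda>_. A)\<^esub> perm_act I p h"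
  using permutes_in_image[OF permutes_inv[OF assms]] by (auto simp: perm_act_def fun_eq_iff)

lemma perm_act_one:
  assumes "p permutes I"
  shows "perm_act I p \<one>\<^bsub>product_group I (\<lambda>_. A)\<^esub> = \<one>\<^bsub>product_group I (\<lambda>_. A)\<^esub>"
  using permutes_in_image[OF permutes_inv[OF assms]] by (auto simp: perm_act_def fun_eq_iff)

lemma group_wreath:
  assumes "group A"
  shows "group (wreath A I)"
proof -
  define P where "P = product_group I (\<lambda>_. A)"
  interpret P: group P using assms by (simp add: P_def)
  have cl: "perm_act I p z \<in> carrier P" if "p permutes I" "z \<in> carrier P" for p z
    using perm_act_closed[OF that(1)] that(2) by (simp add: P_def)
  have pm: "perm_act I p (g \<otimes>\<^bsub>P\<^esub> h) = perm_act I p g \<otimes>\<^bsub>P\<^esub> perm_act I p h" if "p permutes I" for p g h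
    unfolding P_def by (rule perm_act_mult[OF that])
  have p1: "perm_act I id z = z" if "z \<in> carrier P" for z
    using that perm_act_id by (auto simp: P_def)
  have po: "perm_act I p \<one>\<^bsub>P\<^esub> = \<one>\<^bsub>P\<^esub>" if "p permutes I" for p
    unfolding P_def by (rule perm_act_one[OF that])
  show ?thesis
  proof (rule groupI, unfold wreath_def P_def[symmetric])
    let ?W = "\<lparr>carrier = carrier P \<times> {p. p permutes I},
      monoid.mult = \<lambda>(g, p) (h, q). (g \<otimes>\<^bsub>P\<^esub> perm_act I p h, p \<circ> q), one = (\<one>\<^bsub>P\<^esub>, id)\<rparr>"
    show "\<exists>y\<in>carrier ?W. y \<otimes>\<^bsub>?W\<^esub> x = \<one>\<^bsub>?W\<^esub>" if x_in: "x \<in> carrier ?W" for x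
    proof -
      obtain g p where x: "x = (g, p)" and g: "g \<in> carrier P" and p: "p permutes I"
        using x_in by auto
      let ?p = "Hilbert_Choice.inv p"
      have q: "?p permutes I" by (rule permutes_inv[OF p])
      show ?thesis
        by (rule bexI[of _ "(inv\<^bsub>P\<^esub> (perm_act I ?p g), ?p)"])
          (use g p q cl in \<open>auto simp: x P.l_inv permutes_inv_o\<close>)
    qed
  qed (auto simp: cl pm p1 po P.m_assoc permutes_id permutes_compose o_assoc
      perm_act_perm_act)
qed

abbreviation Wn :: "nat \<Rightarrow> ('a, 'm) monoid_scheme \<Rightarrow> ((nat \<Rightarrow> 'a) \<times> (nat \<Rightarrow> nat)) monoid" where
  "Wn n A \<equiv> wreath A {1..n}"

abbreviation base_power :: "nat \<Rightarrow> ('a, 'm) monoid_scheme \<Rightarrow> (nat \<Rightarrow> 'a) monoid" where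
  "base_power n A \<equiv> product_group {1..n} (\<lambda>_. A)"

definition of_base :: "(nat \<Rightarrow> 'a) \<Rightarrow> (nat \<Rightarrow> 'a) \<times> (nat \<Rightarrow> nat)" where
  "of_base x = (x, id)"

definition of_perm ::
  "nat \<Rightarrow> ('a, 'm) monoid_scheme \<Rightarrow> (nat \<Rightarrow> nat) \<Rightarrow> (nat \<Rightarrow> 'a) \<times> (nat \<Rightarrow> nat)" where
  "of_perm n A p = (\<one>\<^bsub>base_power n A\<^esub>, p)"

definition quasi_regular ::
  "nat \<Rightarrow> ('a, 'm) monoid_scheme \<Rightarrow>
    ((nat \<Rightarrow> 'a) \<times> (nat \<Rightarrow> nat), (nat \<Rightarrow> 'a) \<times> (nat \<Rightarrow> nat) \<Rightarrow> complex) rep" where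
  "quasi_regular n A = induced_rep (Wn n A) (of_perm n A ` {p. p permutes {1..n}}) triv_rep"

section \<open>Characters, multiplicity vectors and multislices\<close>

definition characters :: "('a, 'm) monoid_scheme \<Rightarrow> ('a \<Rightarrow> complex) set" where
  "characters A = {\<chi> \<in> carrier A \<rightarrow>\<^sub>E UNIV - {0}.
    \<forall>x\<in>carrier A. \<forall>y\<in>carrier A. \<chi> (x \<otimes>\<^bsub>A\<^esub> y) = \<chi> x * \<chi> y}"

definition multiplicity_vectors ::
  "nat \<Rightarrow> ('a, 'm) monoid_scheme \<Rightarrow> (('a \<Rightarrow> complex) \<Rightarrow> nat) set" where
  "multiplicity_vectors n A =
    {\<kappa> \<in> characters A \<rightarrow>\<^sub>E UNIV. (\<Sum>\<chi>\<in>characters A. \<kappa> \<chi>) = n}"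

definition multislice ::
  "nat \<Rightarrow> ('a, 'm) monoid_scheme \<Rightarrow> (('a \<Rightarrow> complex) \<Rightarrow> nat) \<Rightarrow> (nat \<Rightarrow> 'a \<Rightarrow> complex) set" where
  "multislice n A \<kappa> = {z \<in> {1..n} \<rightarrow>\<^sub>E characters A.
    \<forall>\<chi>\<in>characters A. card {i \<in> {1..n}. z i = \<chi>} = \<kappa> \<chi>}"

definition pairing :: "nat \<Rightarrow> (nat \<Rightarrow> 'a \<Rightarrow> complex) \<Rightarrow> (nat \<Rightarrow> 'a) \<Rightarrow> complex" where
  "pairing n z x = (\<Prod>i=1..n. z i (x i))"

section \<open>The representations \<open>V\<^sub>\<kappa>\<close>\<close>

text \<open>
  Viewing \<open>\<Prod>\<^sub>\<chi> A \<wr> S\<^bsub>\<kappa>(\<chi>)\<^esub>\<close> as a subgroup of \<open>A \<wr> S\<^sub>n\<close> requires splitting \<open>{1..n}\<close> into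
  blocks \<open>B \<chi>\<close> of sizes \<open>\<kappa> \<chi>\<close>. There is no canonical splitting, since the characters are not
  ordered, so the splitting is a parameter.
\<close>

definition blocks ::
  "nat \<Rightarrow> ('a, 'm) monoid_scheme \<Rightarrow> (('a \<Rightarrow> complex) \<Rightarrow> nat) \<Rightarrow> (('a \<Rightarrow> complex) \<Rightarrow> nat set) \<Rightarrow> bool"
  where
  "blocks n A \<kappa> B \<longleftrightarrow> disjoint_family_on B (characters A) \<and> (\<Union>\<chi>\<in>characters A. B \<chi>) = {1..n} \<and>
    (\<forall>\<chi>\<in>characters A. card (B \<chi>) = \<kappa> \<chi>)"

text \<open>
  The part of \<open>(g; p)\<close> on the block \<open>J\<close>. It lies in \<open>A \<wr> Sym(J)\<close> precisely if \<open>p\<close> preserves \<open>J\<close>.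
\<close>

definition block_part ::
  "nat set \<Rightarrow> (nat \<Rightarrow> 'a) \<times> (nat \<Rightarrow> nat) \<Rightarrow> (nat \<Rightarrow> 'a) \<times> (nat \<Rightarrow> nat)" where
  "block_part J = (\<lambda>(g, p). (restrict g J, \<lambda>i. if i \<in> J then p i else i))"

text \<open>
  The subgroup \<open>\<Prod>\<^sub>\<chi> A \<wr> Sym(B \<chi>)\<close>, with factors recovered by \<^const>\<open>block_part\<close>; see
  \<open>block_subgroup_iso\<close> below.
\<close>

definition block_subgroup ::
  "nat \<Rightarrow> ('a, 'm) monoid_scheme \<Rightarrow> (('a \<Rightarrow> complex) \<Rightarrow> nat set) \<Rightarrow> ((nat \<Rightarrow> 'a) \<times> (nat \<Rightarrow> nat)) set"
  where
  "block_subgroup n A B =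
    {w \<in> carrier (Wn n A). \<forall>\<chi>\<in>characters A. block_part (B \<chi>) w \<in> carrier (wreath A (B \<chi>))}"

lemma blocks_exist:
  assumes "\<kappa> \<in> multiplicity_vectors n A" and fin: "finite (characters A)"
  shows "\<exists>B. blocks n A \<kappa> B"
proof -
  have "\<exists>B. disjoint_family_on B X \<and> (\<Union>\<chi>\<in>X. B \<chi>) = {1..sum \<kappa> X} \<and>
      (\<forall>\<chi>\<in>X. card (B \<chi>) = \<kappa> \<chi>)" if "finite X" for X
    using that
  proof (induction X)
    case empty
    then show ?case by (simp add: disjoint_family_on_def)
  next
    case (insert x X)
    then obtain B where B: "disjoint_family_on B X" "(\<Union>\<chi>\<in>X. B \<chi>) = {1..sum \<kappa> X}"
      "\<forall>\<chi>\<in>X. card (B \<chi>) = \<kappa> \<chi>"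
      by blast
    define J where "J = {sum \<kappa> X + 1..sum \<kappa> X + \<kappa> x}"
    have sub: "B \<chi> \<subseteq> {1..sum \<kappa> X}" if "\<chi> \<in> X" for \<chi> using B(2) that by blast
    have dis: "B \<chi> \<inter> J = {}" if "\<chi> \<in> X" for \<chi>
      using sub[OF that] by (auto simp: J_def)
    have img: "(\<Union>\<chi>\<in>X. (B(x := J)) \<chi>) = (\<Union>\<chi>\<in>X. B \<chi>)" using insert.hyps by auto
    show ?case
    proof (intro exI[of _ "B(x := J)"] conjI)
      show "disjoint_family_on (B(x := J)) (insert x X)"
        using B(1) dis insert.hyps by (auto simp: disjoint_family_on_def)
      show "(\<Union>\<chi>\<in>insert x X. (B(x := J)) \<chi>) = {1..sum \<kappa> (insert x X)}"
        using insert.hyps img B(2) by (auto simp: J_def)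
      show "\<forall>\<chi>\<in>insert x X. card ((B(x := J)) \<chi>) = \<kappa> \<chi>"
        using B(3) insert.hyps by (auto simp: J_def)
    qed
  qed
  from this[OF fin] show ?thesis
    using assms(1) by (auto simp: blocks_def multiplicity_vectors_def)
qed

lemma permutes_block:
  assumes "(\<lambda>i. if i \<in> J then p i else i) permutes J" "i \<in> J"
  shows "p i \<in> J"
  using permutes_in_image[OF assms(1), of i] assms(2) by simp

lemma block_subgroup_iff:
  assumes "blocks n A \<kappa> B"
  shows "(g, p) \<in> block_subgroup n A B \<longleftrightarrow>
    g \<in> carrier (base_power n A) \<and> p permutes {1..n} \<and> (\<forall>\<chi>\<in>characters A. p ` B \<chi> \<subseteq> B \<chi>)"
proof -
  have sub: "B \<chi> \<subseteq> {1..n}" if "\<chi> \<in> characters A" for \<chi>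
    using assms that by (auto simp: blocks_def)
  have perm: "(\<lambda>i. if i \<in> B \<chi> then p i else i) permutes B \<chi>"
    if "\<chi> \<in> characters A" "p permutes {1..n}" "p ` B \<chi> \<subseteq> B \<chi>" for \<chi>
  proof (rule bij_imp_permutes)
    have fin: "finite (B \<chi>)" using sub[OF that(1)] by (rule finite_subset) simp
    have inj: "inj_on p (B \<chi>)" using permutes_inj[OF that(2)] by (rule inj_on_subset) simp
    have "p ` B \<chi> = B \<chi>" by (rule endo_inj_surj[OF fin that(3) inj])
    then have "bij_betw p (B \<chi>) (B \<chi>)" using inj by (simp add: bij_betw_def)
    then show "bij_betw (\<lambda>i. if i \<in> B \<chi> then p i else i) (B \<chi>) (B \<chi>)"
      by (subst bij_betw_cong[of _ _ p]) auto
  qed simp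
  have pres: "p ` B \<chi> \<subseteq> B \<chi>" if "(\<lambda>i. if i \<in> B \<chi> then p i else i) permutes B \<chi>" for \<chi>
    using permutes_block[OF that] by auto
  have res: "restrict g (B \<chi>) \<in> B \<chi> \<rightarrow>\<^sub>E carrier A"
    if "\<chi> \<in> characters A" "g \<in> {1..n} \<rightarrow>\<^sub>E carrier A" for \<chi>
    using sub[OF that(1)] that(2) by auto
  show ?thesis
  proof
    assume l: "(g, p) \<in> block_subgroup n A B"
    then have "p ` B \<chi> \<subseteq> B \<chi>" if "\<chi> \<in> characters A" for \<chi>
      using that by (intro pres) (simp add: block_subgroup_def block_part_def wreath_def)
    with l show "g \<in> carrier (base_power n A) \<and> p permutes {1..n} \<and>
        (\<forall>\<chi>\<in>characters A. p ` B \<chi> \<subseteq> B \<chi>)"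
      by (simp add: block_subgroup_def wreath_def)
  next
    assume "g \<in> carrier (base_power n A) \<and> p permutes {1..n} \<and>
        (\<forall>\<chi>\<in>characters A. p ` B \<chi> \<subseteq> B \<chi>)"
    with res perm show "(g, p) \<in> block_subgroup n A B"
      by (simp add: block_subgroup_def block_part_def wreath_def)
  qed
qed

lemma block_subgroup_iso:
  assumes A: "group A" and B: "blocks n A \<kappa> B"
  shows "subgroup (block_subgroup n A B) (Wn n A)"
    and "(\<lambda>w. \<lambda>\<chi>\<in>characters A. block_part (B \<chi>) w) \<in>
      iso ((Wn n A)\<lparr>carrier := block_subgroup n A B\<rparr>)
        (product_group (characters A) (\<lambda>\<chi>. wreath A (B \<chi>)))"
proof -
  let ?X = "characters A" and ?H = "block_subgroup n A B"
  let ?F = "\<lambda>w. \<lambda>\<chi>\<in>?X. block_part (B \<chi>) w"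
  interpret W: group "Wn n A" by (rule group_wreath[OF A])
  note iff = block_subgroup_iff[OF B]
  have sub: "B \<chi> \<subseteq> {1..n}" if "\<chi> \<in> ?X" for \<chi>
    using B that by (auto simp: blocks_def)
  have ex_block: "\<exists>\<chi>\<in>?X. i \<in> B \<chi>" if "i \<in> {1..n}" for i
    using B that unfolding blocks_def by blast
  have im: "p ` B \<chi> = B \<chi>" if "\<chi> \<in> ?X" "p permutes {1..n}" "p ` B \<chi> \<subseteq> B \<chi>" for p \<chi>
    using finite_subset[OF sub[OF that(1)]] inj_on_subset[OF permutes_inj[OF that(2)]] that(3)
    by (intro endo_inj_surj) auto
  have inv_in: "Hilbert_Choice.inv p i \<in> B \<chi>"
    if a: "\<chi> \<in> ?X" "p permutes {1..n}" "p ` B \<chi> \<subseteq> B \<chi>" "i \<in> B \<chi>" for p \<chi> i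
  proof -
    obtain j where "j \<in> B \<chi>" "i = p j" using im[OF a(1-3)] a(4) by blast
    then show ?thesis using permutes_inverses(2)[OF a(2)] by simp
  qed
  show "subgroup ?H (Wn n A)"
  proof (rule W.subgroupI)
    show "?H \<subseteq> carrier (Wn n A)" by (auto simp: block_subgroup_def)
    have "\<one>\<^bsub>Wn n A\<^esub> = (\<one>\<^bsub>base_power n A\<^esub>, id)" by (simp add: wreath_def)
    moreover have "\<one>\<^bsub>base_power n A\<^esub> \<in> carrier (base_power n A)"
      using A by (intro monoid.one_closed group.is_monoid) simp
    ultimately have "\<one>\<^bsub>Wn n A\<^esub> \<in> ?H"
      by (simp add: iff permutes_id del: one_product_group carrier_product_group)
    then show "?H \<noteq> {}" by blast
  next
    fix w assume w: "w \<in> ?H"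
    obtain g p where gp: "w = (g, p)" by (cases w)
    obtain h q where hq: "inv\<^bsub>Wn n A\<^esub> w = (h, q)" by (cases "inv\<^bsub>Wn n A\<^esub> w")
    have p: "p permutes {1..n}" "\<forall>\<chi>\<in>?X. p ` B \<chi> \<subseteq> B \<chi>" using w by (auto simp: iff gp)
    have wc: "w \<in> carrier (Wn n A)" using w by (auto simp: block_subgroup_def)
    have hc: "(h, q) \<in> carrier (Wn n A)" using W.inv_closed[OF wc] hq by simp
    have "w \<otimes>\<^bsub>Wn n A\<^esub> (h, q) = \<one>\<^bsub>Wn n A\<^esub>" using W.r_inv[OF wc] hq by simp
    then have "p \<circ> q = id" by (simp add: gp wreath_def)
    then have "q = Hilbert_Choice.inv p"
      using permutes_inv_o(2)[OF p(1)] by (metis comp_id id_comp o_assoc)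
    then have "(h, q) \<in> ?H"
      using hc inv_in p by (auto simp: iff wreath_def simp del: carrier_product_group)
    then show "inv\<^bsub>Wn n A\<^esub> w \<in> ?H" by (simp only: hq)
  next
    fix w w' assume w: "w \<in> ?H" "w' \<in> ?H"
    obtain g p h q where gp: "w = (g, p)" "w' = (h, q)" by (cases w, cases w')
    have "w \<otimes>\<^bsub>Wn n A\<^esub> w' \<in> carrier (Wn n A)"
      using w by (intro W.m_closed) (auto simp: block_subgroup_def)
    moreover have "(p \<circ> q) ` B \<chi> \<subseteq> B \<chi>" if "\<chi> \<in> ?X" for \<chi>
      using w that by (fastforce simp: iff gp)
    ultimately show "w \<otimes>\<^bsub>Wn n A\<^esub> w' \<in> ?H"
      by (auto simp: gp iff wreath_def simp del: carrier_product_group)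
  qed
  have part_mult: "block_part (B \<chi>) (w \<otimes>\<^bsub>Wn n A\<^esub> w') =
      block_part (B \<chi>) w \<otimes>\<^bsub>wreath A (B \<chi>)\<^esub> block_part (B \<chi>) w'"
    if w: "w \<in> ?H" "w' \<in> ?H" and \<chi>: "\<chi> \<in> ?X" for w w' \<chi>
  proof -
    obtain g p h q where gp: "w = (g, p)" "w' = (h, q)" by (cases w, cases w')
    have p: "p permutes {1..n}" "p ` B \<chi> \<subseteq> B \<chi>" and q: "q ` B \<chi> \<subseteq> B \<chi>"
      using w \<chi> by (auto simp: iff gp)
    let ?p = "\<lambda>i. if i \<in> B \<chi> then p i else i"
    have "?p permutes B \<chi>"
      using w(1) \<chi> by (auto simp: block_subgroup_def block_part_def wreath_def gp)
    then have ip: "Hilbert_Choice.inv ?p i = Hilbert_Choice.inv p i" if "i \<in> B \<chi>" for i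
      using inv_in[OF \<chi> p that] permutes_inverses(1)[OF p(1)] by (simp add: permutes_inv_eq)
    have "restrict (g \<otimes>\<^bsub>base_power n A\<^esub> perm_act {1..n} p h) (B \<chi>) =
        restrict g (B \<chi>) \<otimes>\<^bsub>product_group (B \<chi>) (\<lambda>_. A)\<^esub> perm_act (B \<chi>) ?p (restrict h (B \<chi>))"
    proof
      fix i show "restrict (g \<otimes>\<^bsub>base_power n A\<^esub> perm_act {1..n} p h) (B \<chi>) i =
        (restrict g (B \<chi>) \<otimes>\<^bsub>product_group (B \<chi>) (\<lambda>_. A)\<^esub>
          perm_act (B \<chi>) ?p (restrict h (B \<chi>))) i"
        using subsetD[OF sub[OF \<chi>], of i] ip[of i] inv_in[OF \<chi> p, of i] by (simp add: perm_act_def)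
    qed
    moreover have "(\<lambda>i. if i \<in> B \<chi> then (p \<circ> q) i else i) = ?p \<circ> (\<lambda>i. if i \<in> B \<chi> then q i else i)"
      using q by (auto simp: fun_eq_iff)
    ultimately show ?thesis by (simp add: gp block_part_def wreath_def del: mult_product_group)
  qed
  have F_in: "?F w \<in> (\<Pi>\<^sub>E \<chi>\<in>?X. carrier (wreath A (B \<chi>)))" if "w \<in> ?H" for w
    using that by (auto simp: block_subgroup_def)
  have "?F (w \<otimes>\<^bsub>Wn n A\<^esub> w') = (\<lambda>\<chi>\<in>?X. ?F w \<chi> \<otimes>\<^bsub>wreath A (B \<chi>)\<^esub> ?F w' \<chi>)"
    if "w \<in> ?H" "w' \<in> ?H" for w w'
    using part_mult[OF that] by (auto simp: fun_eq_iff)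
  then have hom: "?F \<in> hom ((Wn n A)\<lparr>carrier := ?H\<rparr>)
      (product_group ?X (\<lambda>\<chi>. wreath A (B \<chi>)))"
    using F_in by (intro homI) simp_all
  have inj: "inj_on ?F ?H"
  proof (rule inj_onI)
    fix w w' assume w: "w \<in> ?H" "w' \<in> ?H" and eq: "?F w = ?F w'"
    obtain g p h q where gp: "w = (g, p)" "w' = (h, q)" by (cases w, cases w')
    have eq': "g i = h i \<and> p i = q i" if "i \<in> {1..n}" for i
    proof -
      obtain \<chi> where \<chi>: "\<chi> \<in> ?X" "i \<in> B \<chi>" using ex_block[OF \<open>i \<in> {1..n}\<close>] by blast
      have "block_part (B \<chi>) w = block_part (B \<chi>) w'" using fun_cong[OF eq, of \<chi>] \<chi>(1) by simp
      then show ?thesis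
        using \<chi>(2) by (auto simp: block_part_def gp dest!: fun_cong[of _ _ i])
    qed
    have "g = h" using w eq' by (intro PiE_ext[of g "{1..n}" "\<lambda>_. carrier A" h]) (simp_all add: gp iff)
    moreover have "p i = q i" for i
      using w eq'[of i] by (cases "i \<in> {1..n}") (auto simp: gp iff permutes_not_in)
    ultimately show "w = w'" by (auto simp: gp)
  qed
  have surj: "u \<in> ?F ` ?H" if u: "u \<in> (\<Pi>\<^sub>E \<chi>\<in>?X. carrier (wreath A (B \<chi>)))" for u
  proof -
    define c where "c i = (THE \<chi>. \<chi> \<in> ?X \<and> i \<in> B \<chi>)" for i
    have c: "c i = \<chi>" if "\<chi> \<in> ?X" "i \<in> B \<chi>" for i \<chi>
      unfolding c_def using B that by (intro the_equality) (auto simp: blocks_def disjoint_family_on_def)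
    have c_ex: "c i \<in> ?X \<and> i \<in> B (c i)" if "i \<in> {1..n}" for i
    proof -
      obtain \<chi> where "\<chi> \<in> ?X" "i \<in> B \<chi>" using ex_block[OF \<open>i \<in> {1..n}\<close>] by blast
      then show ?thesis using c by simp
    qed
    define g where "g = (\<lambda>i\<in>{1..n}. fst (u (c i)) i)"
    define p where "p i = (if i \<in> {1..n} then snd (u (c i)) i else i)" for i
    have ug: "fst (u \<chi>) \<in> B \<chi> \<rightarrow>\<^sub>E carrier A" and up: "snd (u \<chi>) permutes B \<chi>" if "\<chi> \<in> ?X" for \<chi>
      using PiE_mem[OF u that] by (auto simp: wreath_def)
    have p_in: "p i \<in> B (c i)" and p_eq: "p i = snd (u (c i)) i" if "i \<in> {1..n}" for i
      using c_ex[OF that] up[of "c i"] that by (auto simp: p_def permutes_in_image)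
    have c_p: "c (p i) = c i" if "i \<in> {1..n}" for i
      using c c_ex[OF that] p_in[OF that] by blast
    have p: "p permutes {1..n}"
    proof (rule bij_imp_permutes)
      have inj: "inj_on p {1..n}"
      proof (rule inj_onI)
        fix i j assume ij: "i \<in> {1..n}" "j \<in> {1..n}" "p i = p j"
        then have "c i = c j" using c_p by metis
        then have "snd (u (c i)) i = snd (u (c i)) j" using ij p_eq by simp
        then show "i = j" using permutes_inj[OF up[of "c i"]] c_ex[OF ij(1)] by (auto dest: injD)
      qed
      have "p ` {1..n} \<subseteq> {1..n}" using p_in c_ex sub by blast
      then have "p ` {1..n} = {1..n}" using inj by (intro endo_inj_surj) auto
      then show "bij_betw p {1..n} {1..n}" using inj by (simp add: bij_betw_def)
    qed (simp only: p_def if_False)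
    have "g i \<in> carrier A" if "i \<in> {1..n}" for i
      using c_ex[OF that] ug[of "c i"] that by (auto simp: g_def)
    then have "g \<in> carrier (base_power n A)" by (auto simp: g_def)
    moreover have "p ` B \<chi> \<subseteq> B \<chi>" if "\<chi> \<in> ?X" for \<chi>
      using p_in c[OF that] sub[OF that] by fastforce
    ultimately have H: "(g, p) \<in> ?H" using p by (simp add: iff del: carrier_product_group)
    have "block_part (B \<chi>) (g, p) = u \<chi>" if \<chi>: "\<chi> \<in> ?X" for \<chi>
    proof -
      have *: "c i = \<chi>" "i \<in> {1..n}" if "i \<in> B \<chi>" for i
        using c[OF \<chi> that] sub[OF \<chi>] that by blast+
      have "restrict g (B \<chi>) i = fst (u \<chi>) i" for i
        using PiE_arb[OF ug[OF \<chi>], of i] * by (cases "i \<in> B \<chi>") (simp_all add: g_def)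
      moreover have "(if i \<in> B \<chi> then p i else i) = snd (u \<chi>) i" for i
        using permutes_not_in[OF up[OF \<chi>], of i] * by (cases "i \<in> B \<chi>") (simp_all add: p_def)
      ultimately show ?thesis by (simp add: block_part_def prod_eq_iff fun_eq_iff)
    qed
    then have "?F (g, p) \<chi> = u \<chi>" for \<chi>
      using PiE_arb[OF u, of \<chi>] by (cases "\<chi> \<in> ?X") simp_all
    then have "?F (g, p) = u" by (rule ext)
    then show ?thesis using H by blast
  qed
  have "bij_betw ?F ?H (\<Pi>\<^sub>E \<chi>\<in>?X. carrier (wreath A (B \<chi>)))"
    using inj F_in surj unfolding bij_betw_def by blast
  then show "?F \<in> iso ((Wn n A)\<lparr>carrier := ?H\<rparr>)
      (product_group ?X (\<lambda>\<chi>. wreath A (B \<chi>)))"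
    using hom by (simp add: iso_def)
qed

text \<open>The scalar by which an element of \<open>A \<wr> Sym(J)\<close> acts in \<open>\<chi>\<^bsup>\<otimes>J\<^esup>\<close>.\<close>

definition char_power ::
  "nat set \<Rightarrow> ('a \<Rightarrow> complex) \<Rightarrow> (nat \<Rightarrow> 'a) \<times> (nat \<Rightarrow> nat) \<Rightarrow> complex" where
  "char_power J \<chi> = (\<lambda>(g, p). \<Prod>i\<in>J. \<chi> (g i))"

text \<open>The external tensor product of one-dimensional representations multiplies their scalars.\<close>

definition box_char_power ::
  "('a, 'm) monoid_scheme \<Rightarrow> (('a \<Rightarrow> complex) \<Rightarrow> nat set) \<Rightarrow>
    ((nat \<Rightarrow> 'a) \<times> (nat \<Rightarrow> nat), complex) rep" where
  "box_char_power A B =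
    scalar_rep (\<lambda>w. \<Prod>\<chi>\<in>characters A. char_power (B \<chi>) \<chi> (block_part (B \<chi>) w))"

definition Vrep ::
  "nat \<Rightarrow> ('a, 'm) monoid_scheme \<Rightarrow> (('a \<Rightarrow> complex) \<Rightarrow> nat set) \<Rightarrow>
    ((nat \<Rightarrow> 'a) \<times> (nat \<Rightarrow> nat), (nat \<Rightarrow> 'a) \<times> (nat \<Rightarrow> nat) \<Rightarrow> complex) rep" where
  "Vrep n A B = induced_rep (Wn n A) (block_subgroup n A B) (box_char_power A B)"

end

theory Submission
  imports Defs "HOL-Algebra.Multiplicative_Group"
begin

text \<open>
  Let \<open>z\<^sub>0\<close> send \<open>i\<close> to the character whose block contains \<open>i\<close>. The subgroup defining \<open>V\<^sub>\<kappa>\<close> is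
  the stabilizer of \<open>z\<^sub>0\<close> in \<open>A \<wr> S\<^sub>n\<close>, and \<open>\<Omega>\<^sub>\<kappa>\<close> is the orbit of \<open>z\<^sub>0\<close>. The basis vector \<open>e\<^sub>z\<close> is
  the function that maps \<open>(g; p)\<close> to \<open>\<langle>z, g\<rangle>\<^bsup>-1\<^esup>\<close> if \<open>p \<cdot> z\<^sub>0 = z\<close> and to \<open>0\<close> otherwise.
  A function in \<open>P\<^sub>n(A)\<close> is determined by its restriction to \<open>A\<^sup>n\<close>, and the isomorphism sends \<open>f\<close> to
  the family of convolutions \<open>w \<mapsto> \<Sum>\<^sub>h \<langle>z\<^sub>0, h\<rangle> f (w h)\<close>, whose coordinates in the bases above
  are the values of the Fourier transform of that restriction. It is bijective by Fourier inversion
  on \<open>A\<^sup>n\<close>.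
\<close>

text \<open>The two halves of Fourier inversion differ in depth. Surjectivity rests on the
  orthogonality of characters, which only uses that a nontrivial character takes a value other than
  1. Injectivity rests on the dual relation, which needs enough characters to separate points. These
  are built by extending a character from a subgroup \<open>H\<close> by one element
  \<open>x\<close>: the only constraint comes from the least power \<open>x^m\<close> in
  \<open>H\<close>, and its value has an \<open>m\<close>-th root in the complex numbers.

  Both sides of the isomorphism become function spaces by factoring \<open>(g; p)\<close> in
  opposite orders. As \<open>(g; 1)(1; p)\<close> the permutation stands on the right, where
  functions in \<open>P_n(A)\<close> ignore it. As \<open>(1; p)(h; 1)\<close> the base element
  stands on the right, where functions in \<open>V_kappa\<close> turn it into a scalar, leaving
  permutations modulo the stabilizer of the base point. The multislices partition the set of all
  \<open>n\<close>-tuples of characters, so the coordinates of all the \<open>V_kappa\<close>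
  together form one function on that set, the natural domain of the Fourier transform.\<close>

section \<open>Characters of finite abelian groups\<close>

lemma character_nonzero: "\<chi> \<in> characters G \<Longrightarrow> x \<in> carrier G \<Longrightarrow> \<chi> x \<noteq> 0"
  by (auto simp: characters_def)

lemma character_mult:
  "\<lbrakk>\<chi> \<in> characters G; x \<in> carrier G; y \<in> carrier G\<rbrakk> \<Longrightarrow> \<chi> (x \<otimes>\<^bsub>G\<^esub> y) = \<chi> x * \<chi> y"
  by (simp add: characters_def)

context group
begin

lemma character_one: "\<chi> \<in> characters G \<Longrightarrow> \<chi> \<one> = 1"
  using character_mult[of \<chi> G \<one> \<one>] character_nonzero[of \<chi> G \<one>] by simp

lemma character_inv:
  assumes "\<chi> \<in> characters G" "x \<in> carrier G"
  shows "\<chi> (inv x) = inverse (\<chi> x)"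
proof -
  have "\<chi> (inv x) * \<chi> x = 1"
    using assms character_mult[of \<chi> G "inv x" x] by (simp add: character_one)
  then show ?thesis by (metis inverse_unique mult.commute)
qed

lemma character_nat_pow:
  assumes "\<chi> \<in> characters G" "x \<in> carrier G"
  shows "\<chi> (x [^] (k::nat)) = \<chi> x ^ k"
  by (induction k) (use assms in \<open>simp_all add: character_one character_mult\<close>)

lemma character_int_pow:
  assumes "\<chi> \<in> characters G" "x \<in> carrier G"
  shows "\<chi> (x [^] (k::int)) = \<chi> x powi k"
  using assms
  by (cases k rule: int_cases3)
    (simp_all add: int_pow_int int_pow_neg power_int_minus character_nat_pow character_inv character_one)

lemma trivial_character: "(\<lambda>x\<in>carrier G. 1) \<in> characters G"
  by (auto simp: characters_def)

lemma character_times: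
  "\<lbrakk>\<chi> \<in> characters G; \<psi> \<in> characters G\<rbrakk> \<Longrightarrow> (\<lambda>x\<in>carrier G. \<chi> x * \<psi> x) \<in> characters G"
  by (auto simp: characters_def)

lemma character_inverse:
  "\<chi> \<in> characters G \<Longrightarrow> (\<lambda>x\<in>carrier G. inverse (\<chi> x)) \<in> characters G"
  by (auto simp: characters_def)

text \<open>All values are roots of unity of exponent \<open>order G\<close>, so the characters lie
  in a finite function space.\<close>

lemma finite_characters:
  assumes "finite (carrier G)"
  shows "finite (characters G)"
proof (rule finite_subset)
  let ?R = "{z::complex. z ^ order G = 1}"
  have "\<chi> x ^ order G = 1" if "\<chi> \<in> characters G" "x \<in> carrier G" for \<chi> x
    using character_nat_pow[OF that, of "order G"] pow_order_eq_1[OF that(2)] character_one[OF that(1)]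
    by simp
  then show "characters G \<subseteq> carrier G \<rightarrow>\<^sub>E ?R"
    by (auto simp: characters_def)
  have "0 < order G" using assms order_gt_0_iff_finite by simp
  then show "finite (carrier G \<rightarrow>\<^sub>E ?R)"
    using assms by (intro finite_PiE finite_nth_roots) auto
qed

lemma sum_translate:
  assumes "a \<in> carrier G"
  shows "(\<Sum>x\<in>carrier G. f (a \<otimes> x)) = (\<Sum>x\<in>carrier G. f x)"
proof (rule sum.reindex_bij_betw[of "\<lambda>x. a \<otimes> x"])
  show "bij_betw (\<lambda>x. a \<otimes> x) (carrier G) (carrier G)"
    by (rule bij_betwI[of _ _ _ "\<lambda>x. inv a \<otimes> x"]) (use assms in \<open>auto simp: m_assoc[symmetric]\<close>)
qed

text \<open>If \<open>\<chi> a\<close> is not 1, translation by \<open>a\<close> preserves the sum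
  but multiplies it by \<open>\<chi> a\<close>, so the sum vanishes.\<close>

lemma sum_character:
  assumes fin: "finite (carrier G)" and \<chi>: "\<chi> \<in> characters G"
  shows "(\<Sum>x\<in>carrier G. \<chi> x) =
    (if \<chi> = (\<lambda>x\<in>carrier G. 1) then of_nat (card (carrier G)) else 0)"
proof (cases "\<forall>x\<in>carrier G. \<chi> x = 1")
  case True
  then have "\<chi> = (\<lambda>x\<in>carrier G. 1)"
    using \<chi> by (auto simp: characters_def fun_eq_iff PiE_iff extensional_def)
  then show ?thesis by simp
next
  case False
  then obtain a where a: "a \<in> carrier G" "\<chi> a \<noteq> 1" by blast
  have "\<chi> a * (\<Sum>x\<in>carrier G. \<chi> x) = (\<Sum>x\<in>carrier G. \<chi> (a \<otimes> x))"
    using \<chi> a by (simp add: sum_distrib_left character_mult)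
  also have "\<dots> = (\<Sum>x\<in>carrier G. \<chi> x)" by (rule sum_translate[OF a(1)])
  finally have "(\<Sum>x\<in>carrier G. \<chi> x) = 0" using a(2) by simp
  then show ?thesis using a by auto
qed

text \<open>The quotient of two characters is a character, to which the previous sum applies.
  Writing \<open>inverse\<close> instead of complex conjugation avoids any statement about absolute
  values.\<close>

lemma character_orthogonality:
  assumes fin: "finite (carrier G)" and \<chi>: "\<chi> \<in> characters G" and \<psi>: "\<psi> \<in> characters G"
  shows "(\<Sum>x\<in>carrier G. \<chi> x * inverse (\<psi> x)) =
    (if \<chi> = \<psi> then of_nat (card (carrier G)) else 0)"
proof -
  let ?\<theta> = "\<lambda>x\<in>carrier G. \<chi> x * inverse (\<psi> x)"
  have "?\<theta> = (\<lambda>x\<in>carrier G. \<chi> x * (\<lambda>y\<in>carrier G. inverse (\<psi> y)) x)" by auto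
  then have \<theta>: "?\<theta> \<in> characters G"
    using character_times[OF \<chi> character_inverse[OF \<psi>]] by simp
  have "?\<theta> = (\<lambda>x\<in>carrier G. 1) \<longleftrightarrow> \<chi> = \<psi>"
  proof
    assume eq: "?\<theta> = (\<lambda>x\<in>carrier G. 1)"
    have "\<chi> x = \<psi> x" if "x \<in> carrier G" for x
      using fun_cong[OF eq, of x] that character_nonzero[OF \<psi> that] by (simp add: field_simps)
    then show "\<chi> = \<psi>"
      using \<chi> \<psi> by (auto simp: characters_def intro: PiE_ext)
  qed (use character_nonzero[OF \<psi>] in \<open>auto simp: fun_eq_iff\<close>)
  then show ?thesis using sum_character[OF fin \<theta>] by simp
qed

text \<open>For commutative \<open>G\<close> this \<open>m\<close> is the order of the coset of
  \<open>x\<close> modulo \<open>H\<close>. The divisibility clause says that every relation between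
  \<open>x\<close> and \<open>H\<close> comes from \<open>x [^] m\<close>, by division with
  remainder and minimality of \<open>m\<close>.\<close>

lemma obtain_relative_order:
  assumes fin: "finite (carrier G)" and H: "subgroup H G" and x: "x \<in> carrier G"
  obtains m :: nat where "0 < m" "x [^] m \<in> H" "\<forall>k::int. x [^] k \<in> H \<longrightarrow> int m dvd k"
proof -
  let ?P = "\<lambda>m::nat. 0 < m \<and> x [^] m \<in> H"
  define m where "m = (LEAST m. ?P m)"
  have "?P (order G)"
    using fin x pow_order_eq_1[OF x] subgroup.one_closed[OF H] order_gt_0_iff_finite by simp
  then have m: "?P m" unfolding m_def by (rule LeastI[of ?P])
  have "int m dvd k" if k: "x [^] k \<in> H" for k :: int
  proof (rule ccontr)
    assume nd: "\<not> int m dvd k"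
    define r where "r = nat (k mod int m)"
    have "k mod int m \<noteq> 0" using nd by (simp add: dvd_eq_mod_eq_0)
    then have "0 < k mod int m" "k mod int m < int m"
      using pos_mod_sign[of "int m" k] pos_mod_bound[of "int m" k] m by linarith+
    then have r: "0 < r" "r < m" "int r = k - int m * (k div int m)"
      by (simp_all add: r_def nat_less_iff minus_mult_div_eq_mod)
    have "x [^] (int m * (k div int m)) = (x [^] m) [^] (k div int m)"
      using int_pow_pow[OF x, of "int m" "k div int m"] by (simp add: int_pow_int)
    also have "\<dots> \<in> H" using subgroup_int_pow_closed[OF H] m by simp
    finally have "x [^] k \<otimes> inv (x [^] (int m * (k div int m))) \<in> H"
      using k H by (simp add: subgroup.m_closed subgroup.m_inv_closed)
    then have "x [^] int r \<in> H" using x r(3) by (simp add: int_pow_diff)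
    then have "?P r" using r(1) by (simp add: int_pow_int)
    then show False using not_less_Least[of r ?P] r(2) m_def by simp
  qed
  then show ?thesis using m that by blast
qed

end

section \<open>Extension of characters, separation of points, and the dual orthogonality
  relation\<close>

context comm_group
begin

text \<open>The extension lives on the products of \<open>H\<close> with powers of \<open>x\<close>
  and is forced there: \<open>h \<otimes> x [^] k\<close> must go to
  \<open>\<psi> h * c powi k\<close>. The condition \<open>compat\<close> is exactly what makes this
  consistent. Integer exponents give closure under inverses at once.\<close>

lemma character_adjoin:
  assumes H: "subgroup H G" and \<psi>: "\<psi> \<in> characters (G\<lparr>carrier := H\<rparr>)"
    and x: "x \<in> carrier G" and c: "c \<noteq> 0"
    and compat: "\<And>k::int. x [^] k \<in> H \<Longrightarrow> \<psi> (x [^] k) = c powi k"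
  obtains K \<theta> where "subgroup K G" "insert x H \<subseteq> K" "\<theta> \<in> characters (G\<lparr>carrier := K\<rparr>)"
    "\<forall>h\<in>H. \<theta> h = \<psi> h" "\<theta> x = c"
proof -
  define K where "K = (\<lambda>(h, k::int). h \<otimes> x [^] k) ` (H \<times> UNIV)"
  have Hc: "h \<in> carrier G" if "h \<in> H" for h using that subgroup.mem_carrier[OF H] by blast
  have \<psi>m: "\<psi> (h \<otimes> h') = \<psi> h * \<psi> h'" and \<psi>0: "\<psi> h \<noteq> 0" if "h \<in> H" "h' \<in> H" for h h'
    using \<psi> that by (auto simp: characters_def)
  \<comment> \<open>Elements of \<open>K\<close> have many expressions of this kind. Two of them
    differ by a power of \<open>x\<close> lying in \<open>H\<close>, where \<open>compat\<close>
    trades \<open>\<psi>\<close> for a power of \<open>c\<close>; hence the choice made in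
    \<open>\<theta>\<close> below is harmless.\<close>
  have wd: "\<psi> h * c powi k = \<psi> h' * c powi k'"
    if h: "h \<in> H" "h' \<in> H" and eq: "h \<otimes> x [^] k = h' \<otimes> x [^] k'" for h h' and k k' :: int
  proof -
    have "h = h' \<otimes> x [^] k' \<otimes> inv (x [^] k)"
      using eq h x Hc by (metis inv_solve_right int_pow_closed m_closed)
    then have h_eq: "h = h' \<otimes> x [^] (k' - k)"
      using h x Hc by (simp add: int_pow_diff m_assoc)
    then have "x [^] (k' - k) = inv h' \<otimes> h"
      using h x Hc by (metis inv_solve_left int_pow_closed)
    then have in_H: "x [^] (k' - k) \<in> H"
      using h H by (simp add: subgroup.m_closed subgroup.m_inv_closed)
    have "\<psi> h = \<psi> h' * c powi (k' - k)"
      using h_eq \<psi>m[OF h(2) in_H] compat[OF in_H] by simp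
    then show ?thesis using c by (simp add: power_int_diff)
  qed
  define \<theta> where "\<theta> = (\<lambda>y\<in>K. case SOME (h, k::int). h \<in> H \<and> y = h \<otimes> x [^] k of (h, k) \<Rightarrow> \<psi> h * c powi k)"
  have K: "h \<otimes> x [^] k \<in> K" if "h \<in> H" for h and k :: int
    using that by (force simp: K_def)
  have \<theta>: "\<theta> (h \<otimes> x [^] k) = \<psi> h * c powi k" if h: "h \<in> H" for h and k :: int
  proof -
    let ?Q = "\<lambda>(h', k'::int). h' \<in> H \<and> h \<otimes> x [^] k = h' \<otimes> x [^] k'"
    have "?Q (SOME z. ?Q z)" by (rule someI[of ?Q "(h, k)"]) (use h in simp)
    then show ?thesis using wd[OF h] K[OF h, of k] by (auto simp: \<theta>_def split: prod.splits)
  qed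
  have mult: "(h \<otimes> x [^] k) \<otimes> (h' \<otimes> x [^] k') = (h \<otimes> h') \<otimes> x [^] (k + k')"
    if "h \<in> H" "h' \<in> H" for h h' and k k' :: int
    using that Hc x by (simp add: int_pow_mult m_ac)
  have one: "\<one> \<in> H" using subgroup.one_closed[OF H] .
  show ?thesis
  proof
    show "subgroup K G"
    proof (rule subgroupI)
      show "K \<subseteq> carrier G" using Hc x by (auto simp: K_def)
      show "K \<noteq> {}" using one by (auto simp: K_def)
      fix a assume "a \<in> K"
      then obtain h k where a: "a = h \<otimes> x [^] (k::int)" "h \<in> H" by (auto simp: K_def)
      then have "inv a = inv h \<otimes> x [^] (- k)"
        using x Hc by (simp add: inv_mult int_pow_neg)
      then show "inv a \<in> K" using K a(2) H by (simp add: subgroup.m_inv_closed)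
      fix b assume "b \<in> K"
      then obtain h' k' where b: "b = h' \<otimes> x [^] (k'::int)" "h' \<in> H" by (auto simp: K_def)
      show "a \<otimes> b \<in> K"
        using K[of "h \<otimes> h'" "k + k'"] mult a b H by (simp add: subgroup.m_closed)
    qed
    show "insert x H \<subseteq> K"
    proof -
      have "\<one> \<otimes> x [^] (1::int) \<in> K" by (rule K[OF one])
      moreover have "h \<otimes> x [^] (0::int) \<in> K" if "h \<in> H" for h by (rule K[OF that])
      ultimately show ?thesis using x Hc by auto
    qed
    show "\<forall>h\<in>H. \<theta> h = \<psi> h"
    proof
      fix h assume "h \<in> H"
      then show "\<theta> h = \<psi> h" using \<theta>[of h 0] Hc by simp
    qed
    have "\<psi> \<one> = 1" using \<psi>m[OF one one] \<psi>0[OF one one] by simp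
    then show "\<theta> x = c" using \<theta>[OF one, of 1] x by simp
    have "\<theta> (a \<otimes> b) = \<theta> a * \<theta> b" if ab: "a \<in> K" "b \<in> K" for a b
    proof -
      obtain h k h' k' where a: "a = h \<otimes> x [^] (k::int)" "h \<in> H" and b: "b = h' \<otimes> x [^] (k'::int)" "h' \<in> H"
        using ab by (auto simp: K_def)
      have "\<theta> (a \<otimes> b) = \<psi> (h \<otimes> h') * c powi (k + k')"
        using mult[OF a(2) b(2), of k k'] \<theta>[of "h \<otimes> h'" "k + k'"] a b H by (simp add: subgroup.m_closed)
      also have "\<dots> = \<theta> a * \<theta> b"
        using \<psi>m[OF a(2) b(2)] \<theta>[OF a(2), of k] \<theta>[OF b(2), of k'] a(1) b(1) c by (simp add: power_int_add)
      finally show ?thesis .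
    qed
    moreover have "\<theta> a \<noteq> 0" if "a \<in> K" for a
      using that \<theta> \<psi>0 c by (auto simp: K_def)
    ultimately show "\<theta> \<in> characters (G\<lparr>carrier := K\<rparr>)"
      by (auto simp: characters_def \<theta>_def)
  qed
qed

text \<open>Every power of \<open>x\<close> in \<open>H\<close> is a power of
  \<open>x [^] m\<close>, so compatibility has to be arranged only at \<open>x [^] m\<close>, and
  any \<open>m\<close>-th root of its value will do.\<close>

lemma character_adjoin_root:
  assumes H: "subgroup H G" and \<psi>: "\<psi> \<in> characters (G\<lparr>carrier := H\<rparr>)"
    and x: "x \<in> carrier G" and m: "x [^] (m::nat) \<in> H" "\<forall>k::int. x [^] k \<in> H \<longrightarrow> int m dvd k"
    and c: "c ^ m = \<psi> (x [^] m)" "0 < m"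
  obtains K \<theta> where "subgroup K G" "insert x H \<subseteq> K" "\<theta> \<in> characters (G\<lparr>carrier := K\<rparr>)"
    "\<forall>h\<in>H. \<theta> h = \<psi> h" "\<theta> x = c"
proof (rule character_adjoin[OF H \<psi> x])
  have "\<psi> (x [^] m) \<noteq> 0" using character_nonzero[OF \<psi>] m(1) by simp
  then show "c \<noteq> 0" using c by (metis power_0_left less_irrefl)
  fix k :: int assume "x [^] k \<in> H"
  then obtain j where j: "k = int m * j" using m(2) by blast
  \<comment> \<open>\<open>\<psi>\<close> is a character of the subgroup only, so the power of
    \<open>x [^] m\<close> must be read there before the power law applies.\<close>
  interpret H: group "G\<lparr>carrier := H\<rparr>" by (rule subgroup.subgroup_is_group[OF H is_group])
  have "x [^] k = (x [^] m) [^] j" using int_pow_pow[OF x(1), of "int m" j] by (simp add: j int_pow_int)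
  also have "\<dots> = (x [^] m) [^]\<^bsub>G\<lparr>carrier := H\<rparr>\<^esub> j" by (rule int_pow_consistent[OF H m(1)])
  finally have "\<psi> (x [^] k) = \<psi> (x [^] m) powi j"
    using H.character_int_pow[OF \<psi>, of "x [^] m" j] m(1) by (simp only: partial_object.simps) simp
  also have "\<dots> = c powi k" by (simp add: j c(1)[symmetric] power_int_mult)
  finally show "\<psi> (x [^] k) = c powi k" .
qed (use that in blast)

text \<open>Complex roots always exist, so a missing element can be adjoined to \<open>H\<close> at
  any time; the induction is on the number of elements outside \<open>H\<close>.\<close>

lemma character_extend:
  assumes fin: "finite (carrier G)" and H: "subgroup H G" and \<psi>: "\<psi> \<in> characters (G\<lparr>carrier := H\<rparr>)"
  shows "\<exists>\<chi>\<in>characters G. \<forall>h\<in>H. \<chi> h = \<psi> h"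
  using H \<psi>
proof (induction "card (carrier G) - card H" arbitrary: H \<psi> rule: less_induct)
  case less
  note H = less.prems(1) and \<psi> = less.prems(2)
  show ?case
  proof (cases "H = carrier G")
    case True
    then show ?thesis using \<psi> by (auto simp: characters_def)
  next
    case False
    then obtain x where x: "x \<in> carrier G" "x \<notin> H" using subgroup.subset[OF H] by blast
    obtain m where m: "0 < m" "x [^] m \<in> H" "\<forall>k::int. x [^] k \<in> H \<longrightarrow> int m dvd k"
      by (rule obtain_relative_order[OF fin H x(1)])
    have "\<psi> (x [^] m) \<noteq> 0" using character_nonzero[OF \<psi>] m(2) by simp
    then have "card {c. c ^ m = \<psi> (x [^] m)} = m" using m(1) by (rule card_nth_roots)
    then have "{c. c ^ m = \<psi> (x [^] m)} \<noteq> {}" using m(1) by (metis card.empty less_irrefl)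
    then obtain c where c: "c ^ m = \<psi> (x [^] m)" by blast
    obtain K \<theta> where K: "subgroup K G" "insert x H \<subseteq> K" "\<theta> \<in> characters (G\<lparr>carrier := K\<rparr>)"
      "\<forall>h\<in>H. \<theta> h = \<psi> h" "\<theta> x = c"
      by (rule character_adjoin_root[OF H \<psi> x(1) m(2,3) c m(1)])
    have "card H < card K"
      using K(2) x(2) fin subgroup.subset[OF K(1)] by (intro psubset_card_mono) (auto dest: finite_subset)
    moreover have "card K \<le> card (carrier G)"
      using fin subgroup.subset[OF K(1)] by (rule card_mono)
    ultimately have "card (carrier G) - card K < card (carrier G) - card H" by linarith
    then obtain \<chi> where "\<chi> \<in> characters G" "\<forall>h\<in>K. \<chi> h = \<theta> h"
      using less.hyps[OF _ K(1,3)] by blast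
    moreover have "\<forall>h\<in>H. h \<in> K" using K(2) by blast
    ultimately show ?thesis using K(4) by (intro bexI[of _ \<chi>]) simp_all
  qed
qed

text \<open>The order \<open>m\<close> of \<open>x\<close> exceeds 1, so there is an
  \<open>m\<close>-th root of unity \<open>c\<close> other than 1. Adjoining \<open>x\<close> with
  value \<open>c\<close> to the trivial subgroup and extending to \<open>G\<close> gives the
  character.\<close>

lemma characters_separate:
  assumes fin: "finite (carrier G)" and x: "x \<in> carrier G" "x \<noteq> \<one>"
  shows "\<exists>\<chi>\<in>characters G. \<chi> x \<noteq> 1"
proof -
  let ?\<psi> = "\<lambda>y\<in>{\<one>}. 1 :: complex"
  have H: "subgroup {\<one>} G" by (rule triv_subgroup)
  have \<psi>: "?\<psi> \<in> characters (G\<lparr>carrier := {\<one>}\<rparr>)" by (auto simp: characters_def)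
  obtain m where m: "0 < m" "x [^] m \<in> {\<one>}" "\<forall>k::int. x [^] k \<in> {\<one>} \<longrightarrow> int m dvd k"
    by (rule obtain_relative_order[OF fin H x(1)])
  have "m \<noteq> 1" using m(2) x by auto
  have "\<not> {c::complex. c ^ m = 1} \<subseteq> {1}"
  proof
    assume "{c::complex. c ^ m = 1} \<subseteq> {1}"
    then have "card {c::complex. c ^ m = 1} \<le> card {1::complex}" by (intro card_mono) auto
    then show False using card_nth_roots[of 1 m] m(1) \<open>m \<noteq> 1\<close> by simp
  qed
  then obtain c :: complex where c: "c ^ m = 1" "c \<noteq> 1" by auto
  then have cm: "c ^ m = ?\<psi> (x [^] m)" using m(2) by simp
  obtain K \<theta> where K: "subgroup K G" "insert x {\<one>} \<subseteq> K" "\<theta> \<in> characters (G\<lparr>carrier := K\<rparr>)"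
    "\<forall>h\<in>{\<one>}. \<theta> h = ?\<psi> h" "\<theta> x = c"
    by (rule character_adjoin_root[OF H \<psi> x(1) m(2,3) cm m(1)])
  then show ?thesis using character_extend[OF fin K(1,3)] K(2,5) c(2) by (metis insert_subset)
qed

text \<open>Same trick as for \<open>sum_character\<close>, with multiplication by a character
  \<open>\<psi>\<close> that separates \<open>x\<close> from the unit. The value at the unit stays
  \<open>card (characters G)\<close>, because its equality with the order of \<open>G\<close> is
  deduced from this lemma.\<close>

lemma sum_characters:
  assumes fin: "finite (carrier G)" and x: "x \<in> carrier G"
  shows "(\<Sum>\<chi>\<in>characters G. \<chi> x) = (if x = \<one> then of_nat (card (characters G)) else 0)"
proof (cases "x = \<one>")
  case True
  then show ?thesis by (simp add: character_one)
next
  case False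
  then obtain \<psi> where \<psi>: "\<psi> \<in> characters G" "\<psi> x \<noteq> 1" using characters_separate[OF fin x] by blast
  have "\<psi> x * (\<Sum>\<chi>\<in>characters G. \<chi> x) = (\<Sum>\<chi>\<in>characters G. (\<lambda>y\<in>carrier G. \<psi> y * \<chi> y) x)"
    using x by (simp add: sum_distrib_left)
  also have "\<dots> = (\<Sum>\<chi>\<in>characters G. \<chi> x)"
  proof (rule sum.reindex_bij_betw[of "\<lambda>\<chi>. \<lambda>y\<in>carrier G. \<psi> y * \<chi> y" _ _ "\<lambda>\<chi>. \<chi> x"])
    have cancel: "(\<lambda>y\<in>carrier G. a y * (\<lambda>y\<in>carrier G. b y * \<chi> y) y) = \<chi>"
      if "\<chi> \<in> characters G" "\<And>y. y \<in> carrier G \<Longrightarrow> a y * b y = 1" for \<chi> a b :: "'a \<Rightarrow> complex"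
    proof
      fix y
      show "(\<lambda>y\<in>carrier G. a y * (\<lambda>y\<in>carrier G. b y * \<chi> y) y) y = \<chi> y"
        using that(2)[of y] that(1)
        by (cases "y \<in> carrier G") (auto simp: characters_def mult.assoc[symmetric])
    qed
    let ?\<psi>' = "\<lambda>y\<in>carrier G. inverse (\<psi> y)"
    show "bij_betw (\<lambda>\<chi>. \<lambda>y\<in>carrier G. \<psi> y * \<chi> y) (characters G) (characters G)"
    proof (rule bij_betwI)
      show "(\<lambda>\<chi>. \<lambda>y\<in>carrier G. \<psi> y * \<chi> y) \<in> characters G \<rightarrow> characters G"
        using character_times[OF \<psi>(1)] by blast
      show "(\<lambda>\<chi>. \<lambda>y\<in>carrier G. ?\<psi>' y * \<chi> y) \<in> characters G \<rightarrow> characters G"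
        using character_times[OF character_inverse[OF \<psi>(1)]] by blast
      show "(\<lambda>y\<in>carrier G. ?\<psi>' y * (\<lambda>y\<in>carrier G. \<psi> y * \<chi> y) y) = \<chi>"
        if "\<chi> \<in> characters G" for \<chi>
        by (rule cancel[OF that]) (simp add: character_nonzero[OF \<psi>(1)])
      show "(\<lambda>y\<in>carrier G. \<psi> y * (\<lambda>y\<in>carrier G. ?\<psi>' y * \<chi> y) y) = \<chi>"
        if "\<chi> \<in> characters G" for \<chi>
        by (rule cancel[OF that]) (simp add: character_nonzero[OF \<psi>(1)])
    qed
  qed
  finally have "(\<Sum>\<chi>\<in>characters G. \<chi> x) = 0" using \<psi>(2) by simp
  then show ?thesis using False by simp
qed

text \<open>Double counting of the sum of \<open>\<chi> x\<close> over all pairs: by elements only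
  the unit contributes, by characters only the trivial one.\<close>

lemma card_characters:
  assumes fin: "finite (carrier G)"
  shows "card (characters G) = card (carrier G)"
proof -
  have "complex_of_nat (card (characters G)) = (\<Sum>x\<in>carrier G. \<Sum>\<chi>\<in>characters G. \<chi> x)"
    using fin by (simp add: sum_characters sum.delta)
  also have "\<dots> = (\<Sum>\<chi>\<in>characters G. \<Sum>x\<in>carrier G. \<chi> x)" by (rule sum.swap)
  also have "\<dots> = of_nat (card (carrier G))"
    using finite_characters[OF fin] trivial_character by (simp add: sum_character[OF fin])
  finally show ?thesis by (simp only: of_nat_eq_iff)
qed

lemma dual_orthogonality:
  assumes fin: "finite (carrier G)" and x: "x \<in> carrier G" and y: "y \<in> carrier G"
  shows "(\<Sum>\<chi>\<in>characters G. \<chi> x * inverse (\<chi> y)) = (if x = y then of_nat (card (carrier G)) else 0)"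
proof -
  have "(\<Sum>\<chi>\<in>characters G. \<chi> x * inverse (\<chi> y)) = (\<Sum>\<chi>\<in>characters G. \<chi> (x \<otimes> inv y))"
    using x y by (intro sum.cong) (simp_all add: character_mult character_inv)
  moreover have "x \<otimes> inv y = \<one> \<longleftrightarrow> x = y"
    using x y by (metis inv_equality inv_inv inv_closed r_inv)
  ultimately show ?thesis using fin x y by (simp add: sum_characters card_characters)
qed

end

section \<open>Induced representations and direct sums\<close>

text \<open>The definition of a representation asks for a finite set spanning exactly its space, so
  finiteness has to be passed down from an ambient function space.\<close>

lemma (in vector_space) finite_dim_subspace:
  assumes "finite E" "subspace S" "S \<subseteq> span E"
  shows "\<exists>B. finite B \<and> span B = S"
proof -
  obtain B where B: "B \<subseteq> S" "independent B" "S \<subseteq> span B"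
    by (rule maximal_independent_subset)
  have "B \<subseteq> span E" using B(1) assms(3) by (rule subset_trans)
  then have "finite B" using independent_span_bound[OF assms(1) B(2)] by blast
  moreover have "span B = S" by (rule span_subspace[OF B(1,3) assms(2)])
  ultimately show ?thesis by blast
qed

lemma vector_space_pointwise:
  assumes "\<And>k. vector_space (s k)"
  shows "vector_space (\<lambda>c F k. s k c (F k))"
  using assms by (simp add: vector_space_def fun_eq_iff)

text \<open>\<open>F\<close> is the finite sum of its single-coordinate parts. The scaling
  \<open>s\<close> may vary with \<open>k\<close>, so that the same lemma serves vector-valued
  functions on a group and families in a direct sum.\<close>

lemma span_pointwise:
  fixes s :: "'k \<Rightarrow> 'c::field \<Rightarrow> 'v::ab_group_add \<Rightarrow> 'v"
  assumes vs: "\<And>k. vector_space (s k)" and K: "finite K"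
    and F: "\<And>k. k \<in> K \<Longrightarrow> F k \<in> module.span (s k) (E k)" "\<And>k. k \<notin> K \<Longrightarrow> F k = 0"
  shows "F \<in> module.span (\<lambda>c F k. s k c (F k)) (\<Union>k\<in>K. (\<lambda>u. (\<lambda>_. 0)(k := u)) ` E k)"
    (is "_ \<in> module.span _ ?D")
proof -
  interpret P: vector_space "\<lambda>c F k. s k c (F k)" by (rule vector_space_pointwise[OF vs])
  have single: "(\<lambda>_. 0)(k := u) \<in> P.span ?D" if k: "k \<in> K" and u: "u \<in> module.span (s k) (E k)" for k u
  proof -
    interpret k: vector_space "s k" by (rule vs)
    have "k.span (E k) \<subseteq> {u. (\<lambda>_. 0)(k := u) \<in> P.span ?D}"
    proof (rule k.span_minimal)
      show "E k \<subseteq> {u. (\<lambda>_. 0)(k := u) \<in> P.span ?D}"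
        using k by (auto intro!: P.span_base)
      show "k.subspace {u. (\<lambda>_. 0)(k := u) \<in> P.span ?D}"
      proof (rule k.subspaceI)
        have "(\<lambda>_. 0)(k := 0) = (0 :: 'k \<Rightarrow> 'v)" by (auto simp: fun_eq_iff)
        then show "0 \<in> {u. (\<lambda>_. 0)(k := u) \<in> P.span ?D}" using P.span_zero by simp
      next
        fix u v assume "u \<in> {u. (\<lambda>_. 0)(k := u) \<in> P.span ?D}" "v \<in> {u. (\<lambda>_. 0)(k := u) \<in> P.span ?D}"
        then have "(\<lambda>_. 0)(k := u) + (\<lambda>_. 0)(k := v) \<in> P.span ?D" by (simp add: P.span_add)
        moreover have "(\<lambda>_. 0)(k := u) + (\<lambda>_. 0)(k := v) = (\<lambda>_. 0)(k := u + v)" by (auto simp: fun_eq_iff)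
        ultimately show "u + v \<in> {u. (\<lambda>_. 0)(k := u) \<in> P.span ?D}" by simp
      next
        fix c u assume "u \<in> {u. (\<lambda>_. 0)(k := u) \<in> P.span ?D}"
        then have "(\<lambda>j. s j c (((\<lambda>_. 0)(k := u)) j)) \<in> P.span ?D" using P.span_scale by blast
        moreover have "(\<lambda>j. s j c (((\<lambda>_. 0)(k := u)) j)) = (\<lambda>_. 0)(k := s k c u)"
          by (auto simp: fun_eq_iff module.scale_zero_right[OF vs[folded module_iff_vector_space]])
        ultimately show "s k c u \<in> {u. (\<lambda>_. 0)(k := u) \<in> P.span ?D}" by simp
      qed
    qed
    then show ?thesis using u by blast
  qed
  have "F = (\<Sum>k\<in>K. (\<lambda>_. 0)(k := F k))"
  proof
    fix j
    have "(\<Sum>k\<in>K. (\<lambda>_. 0)(k := F k)) j = (\<Sum>k\<in>K. ((\<lambda>_. 0)(k := F k)) j)"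
      by (induction K rule: infinite_finite_induct) simp_all
    also have "\<dots> = (\<Sum>k\<in>K. if k = j then F k else 0)" by (intro sum.cong) auto
    also have "\<dots> = F j" using K F(2) by simp
    finally show "F j = (\<Sum>k\<in>K. (\<lambda>_. 0)(k := F k)) j" by simp
  qed
  moreover have "(\<Sum>k\<in>K. (\<lambda>_. 0)(k := F k)) \<in> P.span ?D"
    using single F(1) by (intro P.span_sum) blast
  ultimately show ?thesis by simp
qed

lemma group_rep_scalar_rep:
  assumes "group G" and "l \<one>\<^bsub>G\<^esub> = 1"
    and "\<And>g h. g \<in> carrier G \<Longrightarrow> h \<in> carrier G \<Longrightarrow> l (g \<otimes>\<^bsub>G\<^esub> h) = l g * l h"
  shows "group_rep G (scalar_rep l)"
proof -
  interpret V: vector_space "(*) :: complex \<Rightarrow> complex \<Rightarrow> complex"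
    by (simp add: vector_space_def algebra_simps)
  have "V.span {1} = UNIV" using V.span_singleton[of 1] by auto
  then have "\<exists>E. finite E \<and> V.span E = UNIV" by (intro exI[of _ "{1}"]) simp
  then show ?thesis
    using assms V.vector_space_axioms V.subspace_UNIV
    by (intro group_rep.intro group_rep_axioms.intro) (simp_all add: scalar_rep_def distrib_left)
qed

lemma (in group_rep) act_zero: "g \<in> carrier G \<Longrightarrow> act R g 0 = 0"
  using act_scal[of g 0 0] subspace_0[OF subspace_space] by simp

lemma group_rep_induced_rep:
  assumes G: "group G" "finite (carrier G)" and H: "subgroup H G"
    and U: "group_rep (G\<lparr>carrier := H\<rparr>) U"
  shows "group_rep G (induced_rep G H U)"
proof -
  interpret G: group G by (rule G)
  interpret U: group_rep "G\<lparr>carrier := H\<rparr>" U by (rule U)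
  let ?S = "rep_space (induced_rep G H U)"
  let ?s = "\<lambda>c f x. scal U c (f x)"
  interpret V: vector_space ?s
    by (rule vector_space_pointwise) (rule U.vector_space_axioms)
  have Hinv: "inv\<^bsub>G\<^esub> h \<in> H" if "h \<in> H" for h using subgroup.m_inv_closed[OF H that] .
  have Hc: "h \<in> carrier G" if "h \<in> H" for h using subgroup.mem_carrier[OF H that] .
  note Ur = U.act_closed U.act_add U.act_scal U.act_zero
  have sub: "V.subspace ?S"
    using Ur Hinv U.subspace_0[OF U.subspace_space] U.subspace_add[OF U.subspace_space]
      U.subspace_scale[OF U.subspace_space]
    by (intro V.subspaceI) (auto simp: induced_rep_def)
  obtain E where E: "finite E" "U.span E = rep_space U" using U.finite_dim by blast
  \<comment> \<open>Dropping equivariance leaves all functions from the finite group to the space of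
    \<open>U\<close>, which are finitely spanned.\<close>
  have "?S \<subseteq> V.span (\<Union>k\<in>carrier G. (\<lambda>u. (\<lambda>_. 0)(k := u)) ` E)"
    using U.vector_space_axioms G(2) E(2)
    by (intro subsetI span_pointwise) (auto simp: induced_rep_def)
  then have fin: "\<exists>E. finite E \<and> V.span E = ?S"
    using G(2) E(1) sub by (intro V.finite_dim_subspace[OF _ sub]) auto
  have closed: "act (induced_rep G H U) g f \<in> ?S" if "g \<in> carrier G" "f \<in> ?S" for g f
    using that Hc by (auto simp: induced_rep_def G.m_assoc[symmetric])
  show ?thesis
  proof (intro group_rep.intro group_rep_axioms.intro)
    show "vector_space (scal (induced_rep G H U))"
      using V.vector_space_axioms by (simp add: induced_rep_def)
    show "module.subspace (scal (induced_rep G H U)) ?S"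
      using sub by (simp add: induced_rep_def)
    show "\<exists>E. finite E \<and> module.span (scal (induced_rep G H U)) E = ?S"
      using fin by (simp add: induced_rep_def)
    show "act (induced_rep G H U) (g \<otimes>\<^bsub>G\<^esub> h) v = act (induced_rep G H U) g (act (induced_rep G H U) h v)"
      if "g \<in> carrier G" "h \<in> carrier G" "v \<in> ?S" for g h v
      using that by (auto simp: induced_rep_def fun_eq_iff G.inv_mult_group G.m_assoc)
  qed (use G closed in \<open>auto simp: induced_rep_def fun_eq_iff U.scale_zero_right\<close>)
qed

text \<open>\<open>vs\<close> ranges over all \<open>k\<close>, since scalars act in every
  coordinate of the ambient function type, also outside \<open>K\<close>.\<close>

lemma group_rep_direct_sum_rep:
  assumes G: "group G" and K: "finite K" and R: "\<And>k. k \<in> K \<Longrightarrow> group_rep G (R k)"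
    and vs: "\<And>k. vector_space (scal (R k))"
  shows "group_rep G (direct_sum_rep K R)"
proof -
  let ?S = "rep_space (direct_sum_rep K R)"
  let ?s = "\<lambda>c F k. scal (R k) c (F k)"
  interpret V: vector_space ?s by (rule vector_space_pointwise[OF vs])
  have z: "scal (R k) c 0 = 0" for k c
    by (rule module.scale_zero_right[OF vs[folded module_iff_vector_space]])
  have sub_k: "module.subspace (scal (R k)) (rep_space (R k))" if "k \<in> K" for k
    using group_rep.subspace_space[OF R[OF that]] .
  have sub: "V.subspace ?S"
  proof (rule V.subspaceI)
    have m: "Modules.module (scal (R k))" for k using vs by (simp add: module_iff_vector_space)
    show "0 \<in> ?S" using module.subspace_0[OF m sub_k] by (simp add: direct_sum_rep_def)
    show "F + F' \<in> ?S" if "F \<in> ?S" "F' \<in> ?S" for F F'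
      using that module.subspace_add[OF m sub_k] by (simp add: direct_sum_rep_def)
    show "(\<lambda>k. scal (R k) c (F k)) \<in> ?S" if "F \<in> ?S" for c F
      using that module.subspace_scale[OF m sub_k] by (simp add: direct_sum_rep_def z)
  qed
  have "\<forall>k\<in>K. \<exists>E. finite E \<and> module.span (scal (R k)) E = rep_space (R k)"
    using group_rep.finite_dim[OF R] by blast
  then obtain E where E: "\<forall>k\<in>K. finite (E k) \<and> module.span (scal (R k)) (E k) = rep_space (R k)"
    by metis
  have "?S \<subseteq> V.span (\<Union>k\<in>K. (\<lambda>u. (\<lambda>_. 0)(k := u)) ` E k)"
    using vs K E by (intro subsetI span_pointwise) (auto simp: direct_sum_rep_def)
  then have fin: "\<exists>E. finite E \<and> V.span E = ?S"
    using K E sub by (intro V.finite_dim_subspace[OF _ sub]) auto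
  note rs = group_rep.act_closed[OF R] group_rep.act_add[OF R] group_rep.act_scal[OF R]
    group_rep.act_one[OF R] group_rep.act_mult[OF R]
  show ?thesis
  proof (intro group_rep.intro group_rep_axioms.intro)
    show "vector_space (scal (direct_sum_rep K R))"
      using V.vector_space_axioms by (simp add: direct_sum_rep_def)
    show "module.subspace (scal (direct_sum_rep K R)) ?S"
      using sub by (simp add: direct_sum_rep_def)
    show "\<exists>E. finite E \<and> module.span (scal (direct_sum_rep K R)) E = ?S"
      using fin by (simp add: direct_sum_rep_def)
  qed (use G rs in \<open>auto simp: direct_sum_rep_def fun_eq_iff z\<close>)
qed

text \<open>Evaluation at \<open>w y\<close> reads off the coefficient of \<open>e y\<close>. This
  gives injectivity and independence, while \<open>expand\<close> gives spanning.\<close>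

lemma rep_basis_dual_points:
  fixes e :: "'z \<Rightarrow> 'x \<Rightarrow> complex"
  assumes s: "scal R = (\<lambda>c f x. c * f x)" and Z: "finite Z"
    and sub: "module.subspace (scal R) (rep_space R)"
    and dual: "\<And>z y. z \<in> Z \<Longrightarrow> y \<in> Z \<Longrightarrow> e z (w y) = (if y = z then 1 else 0)"
    and e: "\<And>z. z \<in> Z \<Longrightarrow> e z \<in> rep_space R"
    and expand: "\<And>f. f \<in> rep_space R \<Longrightarrow> f = (\<lambda>x. \<Sum>z\<in>Z. f (w z) * e z x)"
  shows "rep_basis R Z e"
proof -
  let ?s = "\<lambda>(c::complex) (f::'x \<Rightarrow> complex) x. c * f x"
  interpret V: vector_space ?s by (simp add: vector_space_def fun_eq_iff algebra_simps)
  have sum_fun: "(\<Sum>v\<in>A. g v) x = (\<Sum>v\<in>A. g v x)" for A x and g :: "'y \<Rightarrow> 'x \<Rightarrow> complex"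
    by (induction A rule: infinite_finite_induct) simp_all
  have inj: "inj_on e Z"
  proof (rule inj_onI)
    fix z y assume zy: "z \<in> Z" "y \<in> Z" "e z = e y"
    show "z = y"
    proof (rule ccontr)
      assume "z \<noteq> y"
      then show False using dual[OF zy(1,1)] dual[OF zy(2,1)] zy(3) by simp
    qed
  qed
  have "V.independent (e ` Z)"
  proof (rule V.independent_if_scalars_zero)
    show "finite (e ` Z)" using Z by simp
    fix u v assume 0: "(\<Sum>x\<in>e ` Z. ?s (u x) x) = 0" and "v \<in> e ` Z"
    then obtain z where z: "z \<in> Z" "v = e z" by blast
    have "0 = (\<Sum>x\<in>e ` Z. ?s (u x) x) (w z)" using 0 by simp
    also have "\<dots> = (\<Sum>y\<in>Z. u (e y) * e y (w z))"
      using inj by (simp add: sum_fun sum.reindex)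
    also have "\<dots> = (\<Sum>y\<in>Z. if y = z then u (e y) else 0)"
      using dual z(1) by (intro sum.cong) auto
    also have "\<dots> = u v" using Z z by simp
    finally show "u v = 0" by simp
  qed
  moreover have "V.span (e ` Z) = rep_space R"
  proof (rule V.span_subspace)
    show "rep_space R \<subseteq> V.span (e ` Z)"
    proof
      fix f assume "f \<in> rep_space R"
      then have "f = (\<lambda>x. \<Sum>z\<in>Z. f (w z) * e z x)" by (rule expand)
      also have "\<dots> = (\<Sum>z\<in>Z. ?s (f (w z)) (e z))" by (simp add: fun_eq_iff sum_fun)
      also have "\<dots> \<in> V.span (e ` Z)"
        by (intro V.span_sum V.span_scale V.span_base) simp
      finally show "f \<in> V.span (e ` Z)" .
    qed
  qed (use e sub s in auto)
  ultimately show ?thesis using inj by (simp add: rep_basis_def s)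
qed

section \<open>Wreath products and the pairing\<close>

locale finite_abelian_wreath = A: comm_group A for A :: "('a, 'm) monoid_scheme" +
  fixes n :: nat
  assumes fin: "finite (carrier A)"
begin

abbreviation "P \<equiv> base_power n A"
abbreviation "W \<equiv> Wn n A"
abbreviation "X \<equiv> {1..n} \<rightarrow>\<^sub>E characters A"

sublocale P: group P by (rule product_group) (rule A.is_group)
sublocale W: group W by (rule group_wreath[OF A.is_group])

text \<open>Elements of the power \<open>P\<close> are to be handled by its group laws; coordinates
  are unfolded only on demand. Without \<open>One_nat_def\<close> the index set keeps the form
  \<open>{1..n}\<close>.\<close>

lemmas [simp del] = carrier_product_group mult_product_group one_product_group inv_product_group One_nat_def

lemma base_memD: "g \<in> carrier P \<Longrightarrow> i \<in> {1..n} \<Longrightarrow> g i \<in> carrier A"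
  by (auto simp: carrier_product_group)

lemma finite_base: "finite (carrier P)"
  using fin by (auto simp: carrier_product_group intro: finite_PiE)

lemma finite_X: "finite X"
  using A.finite_characters[OF fin] by (auto intro: finite_PiE)

lemma perm_act_base_closed: "p permutes {1..n} \<Longrightarrow> g \<in> carrier P \<Longrightarrow> perm_act {1..n} p g \<in> carrier P"
  using perm_act_closed by (simp add: carrier_product_group)

lemma perm_act_base_id: "g \<in> carrier P \<Longrightarrow> perm_act {1..n} id g = g"
  using perm_act_id by (auto simp: carrier_product_group)

lemma carrier_W: "(g, p) \<in> carrier W \<longleftrightarrow> g \<in> carrier P \<and> p permutes {1..n}"
  by (simp add: wreath_def)

lemma mult_W: "(g, p) \<otimes>\<^bsub>W\<^esub> (h, q) = (g \<otimes>\<^bsub>P\<^esub> perm_act {1..n} p h, p \<circ> q)"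
  by (simp add: wreath_def)

lemma one_W: "\<one>\<^bsub>W\<^esub> = (\<one>\<^bsub>P\<^esub>, id)"
  by (simp add: wreath_def)

lemma finite_W: "finite (carrier W)"
  using finite_base by (simp add: wreath_def finite_permutations)

lemma of_base_in: "g \<in> carrier P \<Longrightarrow> of_base g \<in> carrier W"
  by (simp add: of_base_def carrier_W permutes_id)

lemma of_perm_in: "p permutes {1..n} \<Longrightarrow> of_perm n A p \<in> carrier W"
  by (simp add: of_perm_def carrier_W)

lemma inv_of_base:
  assumes "g \<in> carrier P"
  shows "inv\<^bsub>W\<^esub> (of_base g) = of_base (inv\<^bsub>P\<^esub> g)"
  using assms of_base_in
  by (intro W.inv_equality) (simp_all add: of_base_def mult_W one_W perm_act_base_id)

lemma inv_of_perm:
  assumes "p permutes {1..n}"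
  shows "inv\<^bsub>W\<^esub> (of_perm n A p) = of_perm n A (Hilbert_Choice.inv p)"
  using assms of_perm_in permutes_inv[OF assms]
  by (intro W.inv_equality)
    (simp_all add: of_perm_def mult_W one_W permutes_inv_o perm_act_one)

lemma pairing_one: "z \<in> X \<Longrightarrow> pairing n z \<one>\<^bsub>P\<^esub> = 1"
  using A.character_one by (auto simp: pairing_def one_product_group intro!: prod.neutral)

lemma pairing_mult:
  assumes "z \<in> X" "g \<in> carrier P" "h \<in> carrier P"
  shows "pairing n z (g \<otimes>\<^bsub>P\<^esub> h) = pairing n z g * pairing n z h"
proof -
  have "z i (g i \<otimes>\<^bsub>A\<^esub> h i) = z i (g i) * z i (h i)" if "i \<in> {1..n}" for i
    using that assms by (intro character_mult base_memD) auto
  then show ?thesis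
    unfolding pairing_def mult_product_group prod.distrib[symmetric] by (intro prod.cong) simp_all
qed

lemma pairing_nonzero:
  assumes "z \<in> X" "g \<in> carrier P"
  shows "pairing n z g \<noteq> 0"
proof -
  have "z i (g i) \<noteq> 0" if "i \<in> {1..n}" for i
    using that assms by (intro character_nonzero[of _ A] base_memD) auto
  then show ?thesis by (simp add: pairing_def)
qed

lemma pairing_inv:
  assumes "z \<in> X" "g \<in> carrier P"
  shows "pairing n z (inv\<^bsub>P\<^esub> g) = inverse (pairing n z g)"
proof -
  have "pairing n z g * pairing n z (inv\<^bsub>P\<^esub> g) = 1"
    using assms pairing_mult[of z g "inv\<^bsub>P\<^esub> g"] by (simp add: pairing_one)
  then show ?thesis by (metis inverse_unique)
qed

lemma pairing_perm_act:
  assumes p: "p permutes {1..n}"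
  shows "pairing n (perm_act {1..n} p z) (perm_act {1..n} p g) = pairing n z g"
proof -
  have "pairing n (perm_act {1..n} p z) (perm_act {1..n} p g) =
      (\<Prod>i\<in>{1..n}. (\<lambda>j. z j (g j)) (Hilbert_Choice.inv p i))"
    unfolding pairing_def perm_act_def by (intro prod.cong) auto
  also have "\<dots> = pairing n z g"
    using prod.permute[OF permutes_inv[OF p], of "\<lambda>j. z j (g j)"] by (simp add: pairing_def comp_def)
  finally show ?thesis .
qed

lemma perm_act_inv:
  assumes p: "p permutes {1..n}" and z: "z \<in> {1..n} \<rightarrow>\<^sub>E S"
  shows "perm_act {1..n} (Hilbert_Choice.inv p) (perm_act {1..n} p z) = z"
    and "perm_act {1..n} p (perm_act {1..n} (Hilbert_Choice.inv p) z) = z"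
  using perm_act_perm_act[OF permutes_inv[OF p] p, of z] perm_act_perm_act[OF p permutes_inv[OF p], of z]
    perm_act_id[OF z] by (simp_all add: permutes_inv_o[OF p])

lemma pairing_perm_act_left:
  assumes p: "p permutes {1..n}" and z: "z \<in> X"
  shows "pairing n (perm_act {1..n} (Hilbert_Choice.inv p) z) g = pairing n z (perm_act {1..n} p g)"
  using pairing_perm_act[OF p, of "perm_act {1..n} (Hilbert_Choice.inv p) z" g] perm_act_inv[OF p z] by simp

text \<open>The pairing is a product of one-coordinate characters, so the sum over the power factors
  into \<open>n\<close> sums over \<open>A\<close>, and one coordinate where the tuples differ makes
  the product zero. The dual relation factors in the same way over tuples of characters.\<close>

lemma pairing_orthogonality:
  assumes z: "z \<in> X" "y \<in> X"
  shows "(\<Sum>g\<in>carrier P. pairing n z g * inverse (pairing n y g)) =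
    (if z = y then of_nat (card (carrier A)) ^ n else 0)"
proof -
  have "(\<Sum>g\<in>carrier P. pairing n z g * inverse (pairing n y g)) =
      (\<Prod>i=1..n. \<Sum>a\<in>carrier A. z i a * inverse (y i a))"
    using fin by (simp add: prod_sum_PiE carrier_product_group pairing_def prod.distrib prod_inversef[symmetric])
  also have "\<dots> = (\<Prod>i=1..n. if z i = y i then of_nat (card (carrier A)) else 0)"
    using z by (intro prod.cong refl A.character_orthogonality[OF fin]) auto
  also have "\<dots> = (if z = y then of_nat (card (carrier A)) ^ n else 0)"
  proof (cases "z = y")
    case False
    then obtain i where "i \<in> {1..n}" "z i \<noteq> y i" using z PiE_ext by blast
    then have "(\<Prod>i=1..n. if z i = y i then of_nat (card (carrier A)) else 0) = (0::complex)"
      by (intro prod_zero) auto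
    then show ?thesis using False by simp
  qed simp
  finally show ?thesis .
qed

lemma pairing_dual_orthogonality:
  assumes g: "g \<in> carrier P" "h \<in> carrier P"
  shows "(\<Sum>z\<in>X. pairing n z g * inverse (pairing n z h)) =
    (if g = h then of_nat (card (carrier A)) ^ n else 0)"
proof -
  have "(\<Sum>z\<in>X. pairing n z g * inverse (pairing n z h)) =
      (\<Prod>i=1..n. \<Sum>\<chi>\<in>characters A. \<chi> (g i) * inverse (\<chi> (h i)))"
    using A.finite_characters[OF fin]
    by (simp add: prod_sum_PiE pairing_def prod.distrib prod_inversef[symmetric])
  also have "\<dots> = (\<Prod>i=1..n. if g i = h i then of_nat (card (carrier A)) else 0)"
    using g by (intro prod.cong refl A.dual_orthogonality[OF fin] base_memD) auto
  also have "\<dots> = (if g = h then of_nat (card (carrier A)) ^ n else 0)"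
  proof (cases "g = h")
    case False
    then obtain i where "i \<in> {1..n}" "g i \<noteq> h i" 
      using g PiE_ext[of g "{1..n}" "\<lambda>_. carrier A" h] by (auto simp: carrier_product_group)
    then have "(\<Prod>i=1..n. if g i = h i then of_nat (card (carrier A)) else 0) = (0::complex)"
      by (intro prod_zero) auto
    then show ?thesis using False by simp
  qed simp
  finally show ?thesis .
qed

text \<open>The base point \<open>z\<^sub>0\<close> of the overview. It takes arbitrary
  \<open>B\<close>, because the blocks vary with the summand in the final decomposition.\<close>

definition block_label :: "(('a \<Rightarrow> complex) \<Rightarrow> nat set) \<Rightarrow> nat \<Rightarrow> 'a \<Rightarrow> complex" where
  "block_label B = (\<lambda>i\<in>{1..n}. THE \<chi>. \<chi> \<in> characters A \<and> i \<in> B \<chi>)"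

text \<open>A chosen representative of the coset of the stabilizer that carries the base point to
  \<open>z\<close>.\<close>

definition transversal ::
  "(('a \<Rightarrow> complex) \<Rightarrow> nat set) \<Rightarrow> (nat \<Rightarrow> 'a \<Rightarrow> complex) \<Rightarrow> nat \<Rightarrow> nat" where
  "transversal B z = (SOME p. p permutes {1..n} \<and> perm_act {1..n} p (block_label B) = z)"

lemma scal_Vrep: "scal (Vrep n A B) = (\<lambda>c f x. c * f x)"
  by (simp add: Vrep_def induced_rep_def box_char_power_def scalar_rep_def)

lemma act_Vrep: "act (Vrep n A B) = (\<lambda>g f x. if x \<in> carrier W then f (inv\<^bsub>W\<^esub> g \<otimes>\<^bsub>W\<^esub> x) else 0)"
  by (simp add: Vrep_def induced_rep_def)

end

section \<open>The basis of \<open>V\<^sub>\<kappa>\<close>\<close>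

locale blocked_wreath = finite_abelian_wreath A n
  for A :: "('a, 'm) monoid_scheme" and n :: nat +
  fixes \<kappa> :: "('a \<Rightarrow> complex) \<Rightarrow> nat" and B :: "('a \<Rightarrow> complex) \<Rightarrow> nat set"
  assumes B: "blocks n A \<kappa> B"
begin

abbreviation "label \<equiv> block_label B"

lemma block_subset: "\<chi> \<in> characters A \<Longrightarrow> B \<chi> \<subseteq> {1..n}"
  using B by (auto simp: blocks_def)

lemma label_eq:
  assumes "\<chi> \<in> characters A" "i \<in> B \<chi>"
  shows "label i = \<chi>"
proof -
  have "i \<in> {1..n}" using assms block_subset by blast
  moreover have "(THE \<chi>. \<chi> \<in> characters A \<and> i \<in> B \<chi>) = \<chi>"
    using B assms by (intro the_equality) (auto simp: blocks_def disjoint_family_on_def)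
  ultimately show ?thesis by (simp add: block_label_def)
qed

lemma label_block:
  assumes "i \<in> {1..n}"
  shows "label i \<in> characters A" "i \<in> B (label i)"
proof -
  obtain \<chi> where "\<chi> \<in> characters A" "i \<in> B \<chi>"
    using B assms unfolding blocks_def by blast
  then show "label i \<in> characters A" "i \<in> B (label i)" using label_eq by simp_all
qed

lemma label_X: "label \<in> X"
  using label_block(1) by (auto simp: block_label_def)

lemma block_eq: "\<chi> \<in> characters A \<Longrightarrow> B \<chi> = {i \<in> {1..n}. label i = \<chi>}"
  using label_eq label_block(2) block_subset by blast

text \<open>Blocks are the level sets of \<open>label\<close>, so preserving every block means that
  \<open>label\<close> is constant along \<open>p\<close>. The base component is free, as it does
  not move labels.\<close>

lemma in_block_subgroup:
  "(g, p) \<in> block_subgroup n A B \<longleftrightarrow>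
    g \<in> carrier P \<and> p permutes {1..n} \<and> perm_act {1..n} p label = label"
proof -
  have "(\<forall>\<chi>\<in>characters A. p ` B \<chi> \<subseteq> B \<chi>) \<longleftrightarrow> perm_act {1..n} p label = label"
    if p: "p permutes {1..n}"
  proof -
    have pin: "p i \<in> {1..n} \<longleftrightarrow> i \<in> {1..n}" for i by (rule permutes_in_image[OF p])
    have "(\<forall>\<chi>\<in>characters A. p ` B \<chi> \<subseteq> B \<chi>) \<longleftrightarrow> (\<forall>i\<in>{1..n}. label (p i) = label i)"
      using label_block(1) pin by (auto simp: block_eq image_subset_iff)
    also have "\<dots> \<longleftrightarrow> perm_act {1..n} p label = label"
    proof
      assume l: "\<forall>i\<in>{1..n}. label (p i) = label i"
      show "perm_act {1..n} p label = label"
      proof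
        fix i
        show "perm_act {1..n} p label i = label i"
        proof (cases "i \<in> {1..n}")
          case True
          then have "Hilbert_Choice.inv p i \<in> {1..n}" using permutes_in_image[OF permutes_inv[OF p]] by simp
          then have "label (p (Hilbert_Choice.inv p i)) = label (Hilbert_Choice.inv p i)" using l by blast
          then show ?thesis using True permutes_inverses[OF p] by (simp add: perm_act_def)
        qed (auto simp: perm_act_def block_label_def)
      qed
    next
      assume l: "perm_act {1..n} p label = label"
      show "\<forall>i\<in>{1..n}. label (p i) = label i"
      proof
        fix i assume "i \<in> {1..n}"
        then have "perm_act {1..n} p label (p i) = label i"
          using pin permutes_inverses[OF p] by (simp add: perm_act_def)
        then show "label (p i) = label i" using l by simp
      qed
    qed
    finally show ?thesis .
  qed
  then show ?thesis by (auto simp: block_subgroup_iff[OF B])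
qed

lemma subgroup_blocks: "subgroup (block_subgroup n A B) W"
  by (rule block_subgroup_iso(1)[OF A.is_group B])

text \<open>The blocks partition the index set and \<open>label\<close> equals \<open>\<chi>\<close>
  throughout \<open>B \<chi>\<close>, so the product over blocks regroups into a single
  pairing.\<close>

lemma box_scalar:
  "(\<Prod>\<chi>\<in>characters A. char_power (B \<chi>) \<chi> (block_part (B \<chi>) w)) = pairing n label (fst w)"
proof -
  obtain g p where w: "w = (g, p)" by (cases w)
  have "(\<Prod>\<chi>\<in>characters A. char_power (B \<chi>) \<chi> (block_part (B \<chi>) w)) =
      (\<Prod>\<chi>\<in>characters A. \<Prod>i\<in>B \<chi>. label i (g i))"
    using label_eq by (intro prod.cong) (auto simp: char_power_def block_part_def w)
  also have "\<dots> = (\<Prod>i\<in>(\<Union>\<chi>\<in>characters A. B \<chi>). label i (g i))"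
    using B A.finite_characters[OF fin] finite_subset[OF block_subset]
    by (intro prod.UNION_disjoint[symmetric]) (auto simp: blocks_def disjoint_family_on_def)
  also have "(\<Union>\<chi>\<in>characters A. B \<chi>) = {1..n}" using B by (simp add: blocks_def)
  finally show ?thesis by (simp add: w pairing_def)
qed

lemma box_char_power_eq: "box_char_power A B = scalar_rep (\<lambda>w. pairing n label (fst w))"
  by (simp add: box_char_power_def box_scalar)

text \<open>Multiplication twists the second base component by \<open>p\<close>; since
  \<open>p\<close> fixes \<open>label\<close>, the pairing with \<open>label\<close> does not notice
  the twist.\<close>

lemma pairing_label_mult:
  assumes "w \<in> block_subgroup n A B" "w' \<in> block_subgroup n A B"
  shows "pairing n label (fst (w \<otimes>\<^bsub>W\<^esub> w')) = pairing n label (fst w) * pairing n label (fst w')"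
proof -
  obtain g p h q where w: "w = (g, p)" "w' = (h, q)" by (cases w, cases w')
  have g: "g \<in> carrier P" "p permutes {1..n}" "perm_act {1..n} p label = label" "h \<in> carrier P"
    using assms by (simp_all add: w in_block_subgroup)
  have "pairing n label (perm_act {1..n} p h) = pairing n label h"
    using pairing_perm_act[OF g(2), of label h] g(3) by simp
  then show ?thesis
    using g label_X by (simp add: w mult_W pairing_mult perm_act_base_closed)
qed

lemma group_rep_box: "group_rep (W\<lparr>carrier := block_subgroup n A B\<rparr>) (box_char_power A B)"
  unfolding box_char_power_eq
  using subgroup.subgroup_is_group[OF subgroup_blocks W.is_group] pairing_label_mult label_X
  by (intro group_rep_scalar_rep) (simp_all add: one_W pairing_one)

lemma group_rep_Vrep: "group_rep W (Vrep n A B)"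
  unfolding Vrep_def
  by (rule group_rep_induced_rep[OF W.is_group finite_W subgroup_blocks group_rep_box])

lemma in_Vrep:
  "f \<in> rep_space (Vrep n A B) \<longleftrightarrow>
    (\<forall>x\<in>carrier W. \<forall>h\<in>block_subgroup n A B. f (x \<otimes>\<^bsub>W\<^esub> h) = inverse (pairing n label (fst h)) * f x) \<and>
    (\<forall>x. x \<notin> carrier W \<longrightarrow> f x = 0)"
proof -
  have "pairing n label (fst (inv\<^bsub>W\<^esub> h)) = inverse (pairing n label (fst h))"
    if h: "h \<in> block_subgroup n A B" for h
  proof -
    have "pairing n label (fst h) * pairing n label (fst (inv\<^bsub>W\<^esub> h)) = 1"
      using pairing_label_mult[OF h subgroup.m_inv_closed[OF subgroup_blocks h]]
        W.r_inv[OF subgroup.mem_carrier[OF subgroup_blocks h]] label_X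
      by (simp add: one_W pairing_one)
    then show ?thesis by (metis inverse_unique)
  qed
  then show ?thesis
    by (simp add: Vrep_def induced_rep_def box_char_power_eq scalar_rep_def)
qed

text \<open>Every \<open>(g, p)\<close> is \<open>of_perm n A p\<close> times a base element on the
  right, and the base group lies in the inducing subgroup.\<close>

lemma Vrep_value:
  assumes f: "f \<in> rep_space (Vrep n A B)" and g: "g \<in> carrier P" and p: "p permutes {1..n}"
  shows "f (g, p) = inverse (pairing n (perm_act {1..n} p label) g) * f (of_perm n A p)"
proof -
  let ?h = "perm_act {1..n} (Hilbert_Choice.inv p) g"
  have h: "?h \<in> carrier P" by (rule perm_act_base_closed[OF permutes_inv[OF p] g])
  have ph: "perm_act {1..n} p ?h = g"
    using perm_act_inv(2)[OF p, of g "carrier A"] g by (simp add: carrier_product_group)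
  have "(g, p) = of_perm n A p \<otimes>\<^bsub>W\<^esub> (?h, id)"
    using g by (simp add: of_perm_def mult_W ph)
  moreover have "(?h, id) \<in> block_subgroup n A B"
    using h perm_act_id[OF label_X] by (simp add: in_block_subgroup permutes_id)
  ultimately have "f (g, p) = inverse (pairing n label ?h) * f (of_perm n A p)"
    using f of_perm_in[OF p] by (simp add: in_Vrep)
  moreover have "pairing n label ?h = pairing n (perm_act {1..n} p label) g"
    using pairing_perm_act[OF p, of label ?h] by (simp add: ph)
  ultimately show ?thesis by simp
qed

text \<open>The permutations differ by \<open>?r\<close> in the stabilizer, whose scalar is 1
  because its base component is trivial. So values on permutations depend only on a point of the
  orbit.\<close>

lemma Vrep_value_cong:
  assumes f: "f \<in> rep_space (Vrep n A B)" and p: "p permutes {1..n}" and q: "q permutes {1..n}"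
    and eq: "perm_act {1..n} p label = perm_act {1..n} q label"
  shows "f (of_perm n A p) = f (of_perm n A q)"
proof -
  let ?r = "Hilbert_Choice.inv q \<circ> p"
  have r: "?r permutes {1..n}" by (rule permutes_compose[OF p permutes_inv[OF q]])
  have "perm_act {1..n} ?r label = perm_act {1..n} (Hilbert_Choice.inv q) (perm_act {1..n} q label)"
    using perm_act_perm_act[OF permutes_inv[OF q] p] eq by metis
  also have "\<dots> = label" by (rule perm_act_inv(1)[OF q label_X])
  finally have "of_perm n A ?r \<in> block_subgroup n A B"
    using r by (simp add: of_perm_def in_block_subgroup)
  moreover have "of_perm n A p = of_perm n A q \<otimes>\<^bsub>W\<^esub> of_perm n A ?r"
    using permutes_inv_o[OF q] by (simp add: of_perm_def mult_W o_assoc perm_act_one[OF q])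
  ultimately show ?thesis
    using f of_perm_in[OF q] label_X by (simp add: in_Vrep of_perm_def pairing_one)
qed

lemma multislice_X: "z \<in> multislice n A \<kappa> \<Longrightarrow> z \<in> X"
  by (simp add: multislice_def)

lemma label_orbit: 
  "multislice n A \<kappa> = (\<lambda>p. perm_act {1..n} p label) ` {p. p permutes {1..n}}"
proof (intro equalityI subsetI)
  fix z assume z: "z \<in> multislice n A \<kappa>"
  have "card {i \<in> {1..n}. z i = \<chi>} = card {i \<in> {1..n}. label i = \<chi>}" for \<chi>
  proof (cases "\<chi> \<in> characters A")
    case True
    then show ?thesis using z B unfolding block_eq[OF True, symmetric] by (simp add: multislice_def blocks_def)
  next
    case False
    then have "{i \<in> {1..n}. z i = \<chi>} = {}" "{i \<in> {1..n}. label i = \<chi>} = {}"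
      using multislice_X[OF z] label_X by auto
    then show ?thesis by (simp only:)
  qed
  \<comment> \<open>Equal fibre sizes mean equal multisets of values, and such tuples differ by a
    permutation of positions.\<close>
  then have "image_mset z (mset_set {1..n}) = image_mset label (mset_set {1..n})"
    by (intro multiset_eqI) (simp add: count_image_mset Int_def vimage_def conj_ac)
  then obtain p where p: "p permutes {1..n}" "\<forall>i\<in>{1..n}. z i = label (p i)"
    using image_mset_eq_implies_permutes[of "{1..n}" z label] by auto
  \<comment> \<open>\<open>z\<close> is \<open>label\<close> composed with \<open>p\<close>, whereas
    \<open>perm_act\<close> composes with the inverse; hence the witness is the inverse of
    \<open>p\<close>.\<close>
  have "perm_act {1..n} (Hilbert_Choice.inv p) label = z"
    using p multislice_X[OF z] by (auto simp: fun_eq_iff perm_act_def permutes_inv_inv PiE_iff extensional_def)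
  then show "z \<in> (\<lambda>p. perm_act {1..n} p label) ` {p. p permutes {1..n}}"
    using permutes_inv[OF p(1)] by blast
next
  fix z assume "z \<in> (\<lambda>p. perm_act {1..n} p label) ` {p. p permutes {1..n}}"
  then obtain p where p: "p permutes {1..n}" "z = perm_act {1..n} p label" by blast
  have "card {i \<in> {1..n}. z i = \<chi>} = \<kappa> \<chi>" if \<chi>: "\<chi> \<in> characters A" for \<chi>
  proof -
    have "{i \<in> {1..n}. z i = \<chi>} = p ` B \<chi>"
    proof (intro equalityI subsetI)
      fix i assume i: "i \<in> {i \<in> {1..n}. z i = \<chi>}"
      then have "Hilbert_Choice.inv p i \<in> B \<chi>"
        using permutes_in_image[OF permutes_inv[OF p(1)]] by (auto simp: block_eq[OF \<chi>] p(2) perm_act_def)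
      then show "i \<in> p ` B \<chi>" using permutes_inverses(1)[OF p(1), of i] by force
    next
      fix i assume "i \<in> p ` B \<chi>"
      then obtain j where j: "j \<in> {1..n}" "label j = \<chi>" "i = p j" using block_eq[OF \<chi>] by auto
      then show "i \<in> {i \<in> {1..n}. z i = \<chi>}"
        using permutes_in_image[OF p(1)] permutes_inverses(2)[OF p(1)] by (auto simp: p(2) perm_act_def)
    qed
    then show ?thesis
      using card_image[OF inj_on_subset[OF permutes_inj[OF p(1)]], of "B \<chi>"] B \<chi> by (simp add: blocks_def)
  qed
  then show "z \<in> multislice n A \<kappa>"
    using perm_act_closed[OF p(1) label_X] by (simp add: multislice_def p(2))
qed

lemma finite_multislice: "finite (multislice n A \<kappa>)"
  by (simp add: label_orbit finite_permutations)

text \<open>The inverse of the pairing is forced by the model of induction, where the subgroup acts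
  on the right through inverses.\<close>

definition orbit_vector :: "(nat \<Rightarrow> 'a \<Rightarrow> complex) \<Rightarrow> (nat \<Rightarrow> 'a) \<times> (nat \<Rightarrow> nat) \<Rightarrow> complex" where
  "orbit_vector z w =
    (if w \<in> carrier W \<and> perm_act {1..n} (snd w) label = z then inverse (pairing n z (fst w)) else 0)"

lemma orbit_vector_in_Vrep:
  assumes z: "z \<in> multislice n A \<kappa>"
  shows "orbit_vector z \<in> rep_space (Vrep n A B)"
proof -
  have "orbit_vector z (w \<otimes>\<^bsub>W\<^esub> h) = inverse (pairing n label (fst h)) * orbit_vector z w"
    if wh: "w \<in> carrier W" "h \<in> block_subgroup n A B" for w h
  proof -
    obtain g p k q where w: "w = (g, p)" "h = (k, q)" by (cases w, cases h)
    have g: "g \<in> carrier P" "p permutes {1..n}" using wh(1) by (simp_all add: w carrier_W)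
    have k: "k \<in> carrier P" "q permutes {1..n}" "perm_act {1..n} q label = label"
      using wh(2) by (simp_all add: w in_block_subgroup)
    have "perm_act {1..n} (p \<circ> q) label = perm_act {1..n} p label"
      using perm_act_perm_act[OF g(2) k(2), of label] k(3) by simp
    moreover have "pairing n (perm_act {1..n} p label) (perm_act {1..n} p k) = pairing n label k"
      by (rule pairing_perm_act[OF g(2)])
    moreover have "w \<otimes>\<^bsub>W\<^esub> h \<in> carrier W"
      using wh subgroup.mem_carrier[OF subgroup_blocks] by simp
    ultimately show ?thesis
      using wh(1) g k multislice_X[OF z]
      by (auto simp: orbit_vector_def w mult_W pairing_mult perm_act_base_closed)
  qed
  then show ?thesis by (simp add: in_Vrep orbit_vector_def)
qed

text \<open>Left translation replaces \<open>g\<close> by the inverse of \<open>x\<close> times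
  \<open>g\<close>; the inverse in \<open>orbit_vector\<close> turns the resulting factor into
  \<open>pairing n z x\<close>.\<close>

lemma of_base_orbit_vector:
  assumes z: "z \<in> multislice n A \<kappa>" and x: "x \<in> carrier P"
  shows "act (Vrep n A B) (of_base x) (orbit_vector z) =
    scal (Vrep n A B) (pairing n z x) (orbit_vector z)"
proof
  fix w :: "(nat \<Rightarrow> 'a) \<times> (nat \<Rightarrow> nat)"
  obtain g p where w: "w = (g, p)" by (cases w)
  show "act (Vrep n A B) (of_base x) (orbit_vector z) w =
    scal (Vrep n A B) (pairing n z x) (orbit_vector z) w"
  proof (cases "w \<in> carrier W")
    case True
    then have g: "g \<in> carrier P" "p permutes {1..n}" by (simp_all add: w carrier_W)
    have "inv\<^bsub>W\<^esub> (of_base x) \<otimes>\<^bsub>W\<^esub> w = (inv\<^bsub>P\<^esub> x \<otimes>\<^bsub>P\<^esub> g, p)"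
      using x g by (simp add: inv_of_base) (simp add: w of_base_def mult_W perm_act_base_id)
    then show ?thesis
      using True g x multislice_X[OF z]
      by (auto simp: act_Vrep scal_Vrep orbit_vector_def w carrier_W pairing_mult pairing_inv)
  qed (simp add: act_Vrep scal_Vrep orbit_vector_def)
qed

text \<open>Translation applies the inverse of \<open>p\<close> to both components. The support
  condition moves to \<open>perm_act {1..n} p z\<close>, and the pairing follows, being invariant
  under simultaneous permutation.\<close>

lemma of_perm_orbit_vector:
  assumes z: "z \<in> multislice n A \<kappa>" and p: "p permutes {1..n}"
  shows "act (Vrep n A B) (of_perm n A p) (orbit_vector z) = orbit_vector (perm_act {1..n} p z)"
proof
  fix w :: "(nat \<Rightarrow> 'a) \<times> (nat \<Rightarrow> nat)"
  obtain g q where w: "w = (g, q)" by (cases w)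
  let ?p = "Hilbert_Choice.inv p"
  have p': "?p permutes {1..n}" by (rule permutes_inv[OF p])
  show "act (Vrep n A B) (of_perm n A p) (orbit_vector z) w = orbit_vector (perm_act {1..n} p z) w"
  proof (cases "w \<in> carrier W")
    case True
    then have g: "g \<in> carrier P" "q permutes {1..n}" by (simp_all add: w carrier_W)
    have pg: "perm_act {1..n} ?p g \<in> carrier P" by (rule perm_act_base_closed[OF p' g(1)])
    have "inv\<^bsub>W\<^esub> (of_perm n A p) \<otimes>\<^bsub>W\<^esub> w = (perm_act {1..n} ?p g, ?p \<circ> q)"
      using p pg by (simp add: inv_of_perm) (simp add: w of_perm_def mult_W)
    moreover have "perm_act {1..n} (?p \<circ> q) label = z \<longleftrightarrow> perm_act {1..n} q label = perm_act {1..n} p z"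
      using perm_act_perm_act[OF p' g(2), of label] perm_act_inv(1)[OF p multislice_X[OF z]]
        perm_act_inv(2)[OF p perm_act_closed[OF g(2) label_X]] by metis
    moreover have "pairing n z (perm_act {1..n} ?p g) = pairing n (perm_act {1..n} p z) g"
      using pairing_perm_act_left[OF p' multislice_X[OF z], of g] by (simp add: permutes_inv_inv[OF p])
    ultimately show ?thesis
      using True g pg permutes_compose[OF g(2) p']
      by (simp add: act_Vrep orbit_vector_def w carrier_W)
  qed (simp add: act_Vrep orbit_vector_def)
qed

lemma transversal:
  assumes "z \<in> multislice n A \<kappa>"
  shows "transversal B z permutes {1..n}" "perm_act {1..n} (transversal B z) label = z"
proof -
  have "\<exists>p. p permutes {1..n} \<and> perm_act {1..n} p label = z"
    using assms unfolding label_orbit by blast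
  from someI_ex[OF this]
  show "transversal B z permutes {1..n}" "perm_act {1..n} (transversal B z) label = z"
    unfolding transversal_def by blast+
qed

text \<open>The basis vectors have disjoint supports: at \<open>(g, p)\<close> only the term for
  \<open>perm_act {1..n} p label\<close> survives.\<close>

lemma orbit_vector_expand:
  assumes f: "f \<in> rep_space (Vrep n A B)"
  shows "f = (\<lambda>w. \<Sum>z\<in>multislice n A \<kappa>. f (of_perm n A (transversal B z)) * orbit_vector z w)"
proof
  fix w :: "(nat \<Rightarrow> 'a) \<times> (nat \<Rightarrow> nat)"
  obtain g p where w: "w = (g, p)" by (cases w)
  let ?y = "perm_act {1..n} p label"
  show "f w = (\<Sum>z\<in>multislice n A \<kappa>. f (of_perm n A (transversal B z)) * orbit_vector z w)"
  proof (cases "w \<in> carrier W")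
    case True
    then have g: "g \<in> carrier P" "p permutes {1..n}" by (simp_all add: w carrier_W)
    then have y: "?y \<in> multislice n A \<kappa>" unfolding label_orbit by blast
    have "(\<Sum>z\<in>multislice n A \<kappa>. f (of_perm n A (transversal B z)) * orbit_vector z w) =
        (\<Sum>z\<in>multislice n A \<kappa>. if ?y = z then f (of_perm n A (transversal B z)) * inverse (pairing n z g) else 0)"
      using True by (intro sum.cong) (simp_all add: orbit_vector_def w)
    also have "\<dots> = f (of_perm n A (transversal B ?y)) * inverse (pairing n ?y g)"
      using y finite_multislice by simp
    also have "\<dots> = f w"
      using Vrep_value[OF f g] Vrep_value_cong[OF f transversal(1)[OF y] g(2)] transversal(2)[OF y]
      by (simp add: w)
    finally show ?thesis by simp
  next
    case False
    then have "f w = 0" using f by (simp add: in_Vrep w)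
    then show ?thesis using False by (simp add: orbit_vector_def)
  qed
qed

lemma orbit_vector_basis: "rep_basis (Vrep n A B) (multislice n A \<kappa>) orbit_vector"
proof (rule rep_basis_dual_points)
  show "orbit_vector z (of_perm n A (transversal B y)) = (if y = z then 1 else 0)"
    if "z \<in> multislice n A \<kappa>" "y \<in> multislice n A \<kappa>" for z y
    using that transversal[OF that(2)] of_perm_in multislice_X[OF that(1)]
    by (auto simp: orbit_vector_def) (simp_all add: of_perm_def pairing_one)
  show "module.subspace (scal (Vrep n A B)) (rep_space (Vrep n A B))"
    by (rule group_rep.subspace_space[OF group_rep_Vrep])
qed (use orbit_vector_expand orbit_vector_in_Vrep finite_multislice scal_Vrep in auto)

end

section \<open>The quasi-regular representation\<close>

context finite_abelian_wreath
begin

lemma subgroup_perms: "subgroup (of_perm n A ` {p. p permutes {1..n}}) W"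
proof (rule W.subgroupI)
  show "of_perm n A ` {p. p permutes {1..n}} \<subseteq> carrier W" using of_perm_in by blast
  show "of_perm n A ` {p. p permutes {1..n}} \<noteq> {}" using permutes_id[of "{1..n}"] by blast
next
  fix a assume "a \<in> of_perm n A ` {p. p permutes {1..n}}"
  then obtain p where p: "a = of_perm n A p" "p permutes {1..n}" by blast
  show "inv\<^bsub>W\<^esub> a \<in> of_perm n A ` {p. p permutes {1..n}}"
    using p permutes_inv[OF p(2)] by (simp add: inv_of_perm)
  fix b assume "b \<in> of_perm n A ` {p. p permutes {1..n}}"
  then obtain q where q: "b = of_perm n A q" "q permutes {1..n}" by blast
  have "a \<otimes>\<^bsub>W\<^esub> b = of_perm n A (p \<circ> q)"
    using p q by (simp add: of_perm_def mult_W perm_act_one)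
  then show "a \<otimes>\<^bsub>W\<^esub> b \<in> of_perm n A ` {p. p permutes {1..n}}"
    using permutes_compose[OF q(2) p(2)] by blast
qed

lemma group_rep_quasi_regular: "group_rep W (quasi_regular n A)"
  unfolding quasi_regular_def triv_rep_def
  using subgroup.subgroup_is_group[OF subgroup_perms W.is_group]
  by (intro group_rep_induced_rep W.is_group finite_W subgroup_perms group_rep_scalar_rep) simp_all

lemma scal_quasi_regular: "scal (quasi_regular n A) = (\<lambda>c f x. c * f x)"
  by (simp add: quasi_regular_def induced_rep_def triv_rep_def scalar_rep_def)

lemma act_quasi_regular:
  "act (quasi_regular n A) = (\<lambda>g f x. if x \<in> carrier W then f (inv\<^bsub>W\<^esub> g \<otimes>\<^bsub>W\<^esub> x) else 0)"
  by (simp add: quasi_regular_def induced_rep_def)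

lemma in_quasi_regular:
  "f \<in> rep_space (quasi_regular n A) \<longleftrightarrow>
    (\<forall>x\<in>carrier W. \<forall>p. p permutes {1..n} \<longrightarrow> f (x \<otimes>\<^bsub>W\<^esub> of_perm n A p) = f x) \<and>
    (\<forall>x. x \<notin> carrier W \<longrightarrow> f x = 0)"
  by (auto simp: quasi_regular_def induced_rep_def triv_rep_def scalar_rep_def)

text \<open>The factorization opposite to that in \<open>Vrep_value\<close>: here the permutation
  stands on the right and is absorbed by invariance.\<close>

lemma quasi_regular_value:
  assumes f: "f \<in> rep_space (quasi_regular n A)" and g: "g \<in> carrier P" and p: "p permutes {1..n}"
  shows "f (g, p) = f (of_base g)"
proof -
  have "(g, p) = of_base g \<otimes>\<^bsub>W\<^esub> of_perm n A p"
    using g by (simp add: of_base_def of_perm_def mult_W perm_act_one[OF permutes_id])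
  then show ?thesis using f of_base_in[OF g] p by (simp add: in_quasi_regular)
qed

lemma sum_perm_act:
  assumes p: "p permutes {1..n}"
  shows "(\<Sum>h\<in>carrier P. F (perm_act {1..n} p h)) = (\<Sum>h\<in>carrier P. F h)"
proof (rule sum.reindex_bij_betw)
  show "bij_betw (perm_act {1..n} p) (carrier P) (carrier P)"
    using perm_act_base_closed[OF p] perm_act_base_closed[OF permutes_inv[OF p]] perm_act_inv[OF p]
    by (intro bij_betwI[of _ _ _ "perm_act {1..n} (Hilbert_Choice.inv p)"])
      (auto simp: carrier_product_group)
qed

section \<open>Fourier inversion on the base group\<close>

definition fourier :: "((nat \<Rightarrow> 'a) \<Rightarrow> complex) \<Rightarrow> (nat \<Rightarrow> 'a \<Rightarrow> complex) \<Rightarrow> complex" where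
  "fourier \<phi> z = (\<Sum>h\<in>carrier P. pairing n z h * \<phi> h)"

definition inverse_fourier :: "((nat \<Rightarrow> 'a \<Rightarrow> complex) \<Rightarrow> complex) \<Rightarrow> (nat \<Rightarrow> 'a) \<Rightarrow> complex" where
  "inverse_fourier c g = (\<Sum>z\<in>X. c z * inverse (pairing n z g)) / of_nat (card (carrier A)) ^ n"

lemma card_nonzero: "of_nat (card (carrier A)) ^ n \<noteq> (0::complex)"
  using fin A.one_closed by auto

text \<open>After interchanging the sums the inner one is the dual relation, so this half, used for
  injectivity, depends on the separation of points.\<close>

lemma inverse_fourier_fourier:
  assumes g: "g \<in> carrier P"
  shows "inverse_fourier (fourier \<phi>) g = \<phi> g"
proof -
  have "(\<Sum>z\<in>X. fourier \<phi> z * inverse (pairing n z g)) =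
      (\<Sum>z\<in>X. \<Sum>h\<in>carrier P. \<phi> h * (pairing n z h * inverse (pairing n z g)))"
    unfolding fourier_def sum_distrib_right by (intro sum.cong refl) simp
  also have "\<dots> = (\<Sum>h\<in>carrier P. \<phi> h * (\<Sum>z\<in>X. pairing n z h * inverse (pairing n z g)))"
    by (subst sum.swap) (simp add: sum_distrib_left)
  also have "\<dots> = (\<Sum>h\<in>carrier P. if h = g then \<phi> h * of_nat (card (carrier A)) ^ n else 0)"
    using g by (intro sum.cong) (simp_all add: pairing_dual_orthogonality)
  also have "\<dots> = \<phi> g * of_nat (card (carrier A)) ^ n" using g finite_base by simp
  finally show ?thesis using card_nonzero by (simp add: inverse_fourier_def)
qed

text \<open>This half, used for surjectivity, reduces to ordinary orthogonality.\<close>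

lemma fourier_inverse_fourier:
  assumes z: "z \<in> X"
  shows "fourier (inverse_fourier c) z = c z"
proof -
  have "fourier (inverse_fourier c) z =
      (\<Sum>h\<in>carrier P. \<Sum>y\<in>X. c y * (pairing n z h * inverse (pairing n y h))) / of_nat (card (carrier A)) ^ n"
    unfolding fourier_def inverse_fourier_def sum_distrib_left sum_divide_distrib
    by (intro sum.cong refl) simp
  also have "(\<Sum>h\<in>carrier P. \<Sum>y\<in>X. c y * (pairing n z h * inverse (pairing n y h))) =
      (\<Sum>y\<in>X. c y * (\<Sum>h\<in>carrier P. pairing n z h * inverse (pairing n y h)))"
    by (subst sum.swap) (simp add: sum_distrib_left)
  also have "\<dots> = (\<Sum>y\<in>X. if z = y then c y * of_nat (card (carrier A)) ^ n else 0)"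
    using z by (intro sum.cong) (simp_all add: pairing_orthogonality)
  also have "\<dots> = c z * of_nat (card (carrier A)) ^ n" using z finite_X by simp
  finally show ?thesis using card_nonzero by auto
qed

text \<open>Convolution on the right with the character \<open>z\<close> of the base group: it commutes with left
  translation, and turns right invariance under permutations into equivariance under the
  stabilizer of \<open>z\<close>.\<close>

definition convolve ::
  "(nat \<Rightarrow> 'a \<Rightarrow> complex) \<Rightarrow> ((nat \<Rightarrow> 'a) \<times> (nat \<Rightarrow> nat) \<Rightarrow> complex) \<Rightarrow>
    (nat \<Rightarrow> 'a) \<times> (nat \<Rightarrow> nat) \<Rightarrow> complex" where
  "convolve z f w =
    (if w \<in> carrier W then \<Sum>h\<in>carrier P. pairing n z h * f (w \<otimes>\<^bsub>W\<^esub> of_base h) else 0)"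

lemma convolve_add: "convolve z (f + f') = convolve z f + convolve z f'"
  by (simp add: convolve_def fun_eq_iff distrib_left sum.distrib)

lemma convolve_scale: "convolve z (\<lambda>x. c * f x) = (\<lambda>x. c * convolve z f x)"
  by (simp add: convolve_def fun_eq_iff sum_distrib_left mult_ac)

lemma convolve_translate:
  assumes g: "g \<in> carrier W"
  shows "convolve z (act (quasi_regular n A) g f) w =
    (if w \<in> carrier W then convolve z f (inv\<^bsub>W\<^esub> g \<otimes>\<^bsub>W\<^esub> w) else 0)"
  using g of_base_in by (simp add: convolve_def act_quasi_regular W.m_assoc)

text \<open>Moving \<open>of_perm n A p\<close> to the right past \<open>of_base h\<close> replaces
  \<open>h\<close> by its permuted tuple, and invariance of \<open>f\<close> removes the
  permutation. Reindexing by the permuted tuple then permutes \<open>z\<close>.\<close>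

lemma convolve_of_perm:
  assumes f: "f \<in> rep_space (quasi_regular n A)" and p: "p permutes {1..n}"
  shows "convolve z f (of_perm n A p) = fourier (f \<circ> of_base) (perm_act {1..n} p z)"
proof -
  have "f (of_perm n A p \<otimes>\<^bsub>W\<^esub> of_base h) = f (of_base (perm_act {1..n} p h))"
    if "h \<in> carrier P" for h
    using that p quasi_regular_value[OF f perm_act_base_closed[OF p that] p] perm_act_base_closed[OF p that]
    by (simp add: of_perm_def of_base_def mult_W)
  then have "convolve z f (of_perm n A p) =
      (\<Sum>h\<in>carrier P. pairing n (perm_act {1..n} p z) (perm_act {1..n} p h) *
        f (of_base (perm_act {1..n} p h)))"
    using of_perm_in[OF p] by (simp add: convolve_def pairing_perm_act[OF p])
  also have "\<dots> = fourier (f \<circ> of_base) (perm_act {1..n} p z)"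
    by (subst sum_perm_act[OF p]) (simp add: fourier_def)
  finally show ?thesis .
qed

section \<open>The partition of the tuples of characters into multislices\<close>

definition shape :: "(nat \<Rightarrow> 'a \<Rightarrow> complex) \<Rightarrow> ('a \<Rightarrow> complex) \<Rightarrow> nat" where
  "shape z = (\<lambda>\<chi>\<in>characters A. card {i \<in> {1..n}. z i = \<chi>})"

text \<open>Together with \<open>shape_eq\<close> this shows that each tuple lies in exactly one
  multislice, hence indexes one coordinate of the direct sum.\<close>

lemma shape_multiplicity_vector:
  assumes "z \<in> X"
  shows "shape z \<in> multiplicity_vectors n A" "z \<in> multislice n A (shape z)"
proof -
  have "(\<Sum>\<chi>\<in>characters A. \<Sum>i\<in>{i \<in> {1..n}. z i = \<chi>}. 1) = (\<Sum>i\<in>{1..n}. 1::nat)"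
    using assms A.finite_characters[OF fin] by (intro sum.group) auto
  then show "shape z \<in> multiplicity_vectors n A"
    by (simp add: multiplicity_vectors_def shape_def)
  show "z \<in> multislice n A (shape z)"
    using assms by (simp add: multislice_def shape_def)
qed

lemma shape_eq:
  assumes "\<kappa> \<in> multiplicity_vectors n A" "z \<in> multislice n A \<kappa>"
  shows "shape z = \<kappa>"
proof
  fix \<chi> show "shape z \<chi> = \<kappa> \<chi>"
    using assms by (cases "\<chi> \<in> characters A") (auto simp: multiplicity_vectors_def multislice_def shape_def)
qed

lemma finite_multiplicity_vectors: "finite (multiplicity_vectors n A)"
proof (rule finite_subset)
  note fc = A.finite_characters[OF fin]
  show "multiplicity_vectors n A \<subseteq> characters A \<rightarrow>\<^sub>E {..n}"
    using member_le_sum[OF _ _ fc] by (fastforce simp: multiplicity_vectors_def)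
  show "finite (characters A \<rightarrow>\<^sub>E {..n})" using fc by (intro finite_PiE) auto
qed

end

section \<open>The components of the isomorphism\<close>

context blocked_wreath
begin

text \<open>Pushing \<open>u\<close> to the right past \<open>of_base h\<close> changes
  \<open>h\<close> to \<open>?s h\<close> and leaves the permutation \<open>q\<close> at the far
  right, where \<open>f\<close> ignores it. As \<open>q\<close> fixes \<open>label\<close>, the
  substitution costs only the scalar of \<open>k\<close>.\<close>

lemma convolve_label_in_Vrep:
  assumes f: "f \<in> rep_space (quasi_regular n A)"
  shows "convolve label f \<in> rep_space (Vrep n A B)"
proof -
  have "convolve label f (w \<otimes>\<^bsub>W\<^esub> u) = inverse (pairing n label (fst u)) * convolve label f w"
    if wu: "w \<in> carrier W" "u \<in> block_subgroup n A B" for w u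
  proof -
    obtain k q where u: "u = (k, q)" by (cases u)
    have k: "k \<in> carrier P" "q permutes {1..n}" "perm_act {1..n} q label = label"
      using wu(2) by (simp_all add: u in_block_subgroup)
    have uc: "u \<in> carrier W" by (rule subgroup.mem_carrier[OF subgroup_blocks wu(2)])
    let ?s = "\<lambda>h. k \<otimes>\<^bsub>P\<^esub> perm_act {1..n} q h"
    have s: "?s h \<in> carrier P" if "h \<in> carrier P" for h
      using that k by (simp add: perm_act_base_closed)
    have pair: "pairing n label h = inverse (pairing n label k) * pairing n label (?s h)"
      if h: "h \<in> carrier P" for h
    proof -
      have "pairing n label (?s h) = pairing n label k * pairing n label (perm_act {1..n} q h)"
        using h k label_X by (simp add: pairing_mult perm_act_base_closed)
      also have "pairing n label (perm_act {1..n} q h) = pairing n label h"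
        using pairing_perm_act[OF k(2), of label h] k(3) by simp
      finally show ?thesis using pairing_nonzero[OF label_X k(1)] by simp
    qed
    have val: "f (w \<otimes>\<^bsub>W\<^esub> u \<otimes>\<^bsub>W\<^esub> of_base h) = f (w \<otimes>\<^bsub>W\<^esub> of_base (?s h))"
      if h: "h \<in> carrier P" for h
    proof -
      have "u \<otimes>\<^bsub>W\<^esub> of_base h = of_base (?s h) \<otimes>\<^bsub>W\<^esub> of_perm n A q"
        using s[OF h] by (simp add: u of_base_def of_perm_def mult_W perm_act_one[OF permutes_id])
      then have "w \<otimes>\<^bsub>W\<^esub> u \<otimes>\<^bsub>W\<^esub> of_base h = w \<otimes>\<^bsub>W\<^esub> of_base (?s h) \<otimes>\<^bsub>W\<^esub> of_perm n A q"
        using wu(1) uc h s[OF h] k(2) by (simp add: W.m_assoc of_base_in of_perm_in)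
      then show ?thesis
        using f wu(1) of_base_in[OF s[OF h]] k(2) by (simp add: in_quasi_regular)
    qed
    have "convolve label f (w \<otimes>\<^bsub>W\<^esub> u) =
        (\<Sum>h\<in>carrier P. inverse (pairing n label k) * pairing n label (?s h) * f (w \<otimes>\<^bsub>W\<^esub> of_base (?s h)))"
      using wu(1) uc val pair by (simp add: convolve_def cong: sum.cong)
    \<comment> \<open>The substitution \<open>?s\<close> is undone in two bijective moves: the
      permutation by \<open>q\<close>, then the translation by \<open>k\<close>.\<close>
    also have "\<dots> = (\<Sum>h\<in>carrier P.
        inverse (pairing n label k) * pairing n label (k \<otimes>\<^bsub>P\<^esub> h) * f (w \<otimes>\<^bsub>W\<^esub> of_base (k \<otimes>\<^bsub>P\<^esub> h)))"
      by (rule sum_perm_act[OF k(2)])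
    also have "\<dots> = (\<Sum>h\<in>carrier P.
        inverse (pairing n label k) * pairing n label h * f (w \<otimes>\<^bsub>W\<^esub> of_base h))"
      by (rule P.sum_translate[OF k(1)])
    also have "\<dots> = inverse (pairing n label (fst u)) * convolve label f w"
      using wu(1) by (simp add: convolve_def u sum_distrib_left mult_ac)
    finally show ?thesis .
  qed
  then show ?thesis by (simp add: in_Vrep convolve_def)
qed

lemma Vrep_eqI:
  assumes f: "f \<in> rep_space (Vrep n A B)" and f': "f' \<in> rep_space (Vrep n A B)"
    and eq: "\<And>p. p permutes {1..n} \<Longrightarrow> f (of_perm n A p) = f' (of_perm n A p)"
  shows "f = f'"
proof
  fix w :: "(nat \<Rightarrow> 'a) \<times> (nat \<Rightarrow> nat)"
  obtain g p where w: "w = (g, p)" by (cases w)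
  show "f w = f' w"
  proof (cases "w \<in> carrier W")
    case True
    then have g: "g \<in> carrier P" "p permutes {1..n}" by (simp_all add: w carrier_W)
    then show ?thesis using Vrep_value[OF f g] Vrep_value[OF f' g] eq by (simp add: w)
  next
    case False
    then show ?thesis using f f' by (simp add: in_Vrep w)
  qed
qed

end

section \<open>Assembling the decomposition\<close>

context finite_abelian_wreath
begin

lemma quasi_regular_decomposition:
  fixes B :: "(('a \<Rightarrow> complex) \<Rightarrow> nat) \<Rightarrow> ('a \<Rightarrow> complex) \<Rightarrow> nat set"
  assumes B: "\<And>\<kappa>. \<kappa> \<in> multiplicity_vectors n A \<Longrightarrow> blocks n A \<kappa> (B \<kappa>)"
  shows "rep_iso W (quasi_regular n A) (direct_sum_rep (multiplicity_vectors n A) (\<lambda>\<kappa>. Vrep n A (B \<kappa>)))"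
proof -
  let ?M = "multiplicity_vectors n A" and ?Q = "quasi_regular n A"
  let ?D = "direct_sum_rep ?M (\<lambda>\<kappa>. Vrep n A (B \<kappa>))"
  have bw: "blocked_wreath A n \<kappa> (B \<kappa>)" if "\<kappa> \<in> ?M" for \<kappa>
    using finite_abelian_wreath_axioms B[OF that] by (simp add: blocked_wreath_def blocked_wreath_axioms_def)
  \<comment> \<open>Scalars act pointwise for any \<open>B \<kappa>\<close>, so this covers the
    \<open>\<kappa>\<close> outside \<open>?M\<close>, where \<open>B \<kappa>\<close> need not be a
    splitting into blocks.\<close>
  have "vector_space (scal (Vrep n A (B \<kappa>)))" for \<kappa>
    unfolding scal_Vrep by (simp add: vector_space_def fun_eq_iff algebra_simps)
  then have D: "group_rep W ?D"
    using blocked_wreath.group_rep_Vrep[OF bw] finite_multiplicity_vectors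
    by (intro group_rep_direct_sum_rep W.is_group) auto
  define T where "T f \<kappa> = (if \<kappa> \<in> ?M then convolve (block_label (B \<kappa>)) f else 0)" for f \<kappa>
  have T_in: "T f \<in> rep_space ?D" if "f \<in> rep_space ?Q" for f
    using that blocked_wreath.convolve_label_in_Vrep[OF bw] by (simp add: direct_sum_rep_def T_def)
  have T_val: "T f \<kappa> (of_perm n A p) = fourier (f \<circ> of_base) (perm_act {1..n} p (block_label (B \<kappa>)))"
    if "\<kappa> \<in> ?M" "f \<in> rep_space ?Q" "p permutes {1..n}" for f \<kappa> p
    using that by (simp add: T_def convolve_of_perm)
  have inj: "inj_on T (rep_space ?Q)"
  proof (rule inj_onI)
    fix f f' assume f: "f \<in> rep_space ?Q" and f': "f' \<in> rep_space ?Q" and eq: "T f = T f'"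
    \<comment> \<open>Every \<open>z\<close> is seen by the component of its own shape, at a
      permutation carrying the base point of that component to \<open>z\<close>.\<close>
    have four: "fourier (f \<circ> of_base) z = fourier (f' \<circ> of_base) z" if z: "z \<in> X" for z
    proof -
      note s = shape_multiplicity_vector[OF z]
      obtain p where p: "p permutes {1..n}" "perm_act {1..n} p (block_label (B (shape z))) = z"
        using blocked_wreath.transversal[OF bw[OF s(1)] s(2)] by blast
      show ?thesis using T_val[OF s(1) f p(1)] T_val[OF s(1) f' p(1)] eq p(2) by simp
    qed
    have base: "f (of_base g) = f' (of_base g)" if g: "g \<in> carrier P" for g
    proof -
      have "inverse_fourier (fourier (f \<circ> of_base)) g = inverse_fourier (fourier (f' \<circ> of_base)) g"
        using four by (simp add: inverse_fourier_def)
      then show ?thesis using g by (simp add: inverse_fourier_fourier)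
    qed
    show "f = f'"
    proof
      fix w :: "(nat \<Rightarrow> 'a) \<times> (nat \<Rightarrow> nat)"
      obtain g p where w: "w = (g, p)" by (cases w)
      show "f w = f' w"
      proof (cases "w \<in> carrier W")
        case True
        then have g: "g \<in> carrier P" "p permutes {1..n}" by (simp_all add: w carrier_W)
        show ?thesis
          using quasi_regular_value[OF f g] quasi_regular_value[OF f' g] base[OF g(1)] by (simp add: w)
      next
        case False
        then show ?thesis using f f' by (simp add: in_quasi_regular w)
      qed
    qed
  qed
  have surj: "F \<in> T ` rep_space ?Q" if F: "F \<in> rep_space ?D" for F
  proof -
    have FV: "F \<kappa> \<in> rep_space (Vrep n A (B \<kappa>))" if "\<kappa> \<in> ?M" for \<kappa>
      using F that by (simp add: direct_sum_rep_def)
    \<comment> \<open>All coordinates of \<open>F\<close> are collected into one function on tuples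
      of characters; the preimage \<open>f\<close> is its inverse transform, made independent of the
      permutation.\<close>
    define c where "c z = F (shape z) (of_perm n A (transversal (B (shape z)) z))" for z
    define f where "f w = (if w \<in> carrier W then inverse_fourier c (fst w) else 0)" for w
    have f: "f \<in> rep_space ?Q"
      unfolding in_quasi_regular
    proof (intro conjI ballI allI impI)
      fix x p assume x: "x \<in> carrier W" and p: "p permutes {1..n}"
      obtain g q where gq: "x = (g, q)" by (cases x)
      have "fst (x \<otimes>\<^bsub>W\<^esub> of_perm n A p) = fst x"
        using x by (simp add: gq carrier_W of_perm_def mult_W perm_act_one)
      then show "f (x \<otimes>\<^bsub>W\<^esub> of_perm n A p) = f x"
        using x of_perm_in[OF p] by (simp add: f_def)
    qed (simp add: f_def)
    have four: "fourier (f \<circ> of_base) z = c z" if z: "z \<in> X" for z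
    proof -
      have "fourier (f \<circ> of_base) z = fourier (inverse_fourier c) z"
        using of_base_in by (auto simp: fourier_def f_def of_base_def intro!: sum.cong)
      then show ?thesis by (simp add: fourier_inverse_fourier[OF z])
    qed
    have "T f \<kappa> = F \<kappa>" for \<kappa>
    proof (cases "\<kappa> \<in> ?M")
      case True
      interpret V: blocked_wreath A n \<kappa> "B \<kappa>" by (rule bw[OF True])
      show ?thesis
      proof (rule V.Vrep_eqI)
        show "T f \<kappa> \<in> rep_space (Vrep n A (B \<kappa>))"
          using T_in[OF f] True by (simp add: direct_sum_rep_def)
        show "F \<kappa> \<in> rep_space (Vrep n A (B \<kappa>))" by (rule FV[OF True])
        fix p assume p: "p permutes {1..n}"
        let ?z = "perm_act {1..n} p V.label"
        have z: "?z \<in> multislice n A \<kappa>" using p unfolding V.label_orbit by blast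
        have "T f \<kappa> (of_perm n A p) = c ?z"
          using T_val[OF True f p] four[OF V.multislice_X[OF z]] by simp
        also have "\<dots> = F \<kappa> (of_perm n A (transversal (B \<kappa>) ?z))"
          by (simp add: c_def shape_eq[OF True z])
        \<comment> \<open>The chosen representative may differ from \<open>p\<close>, but both carry
          the base point to \<open>?z\<close>.\<close>
        also have "\<dots> = F \<kappa> (of_perm n A p)"
          using V.transversal[OF z] p by (intro V.Vrep_value_cong[OF FV[OF True]]) auto
        finally show "T f \<kappa> (of_perm n A p) = F \<kappa> (of_perm n A p)" .
      qed
    next
      case False
      then show ?thesis using F by (simp add: T_def direct_sum_rep_def)
    qed
    then have "T f = F" by (rule ext)
    then show ?thesis using f by blast
  qed
  have "bij_betw T (rep_space ?Q) (rep_space ?D)"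
    using inj T_in surj unfolding bij_betw_def by blast
  moreover have "T (f + f') = T f + T f'" for f f'
    by (rule ext) (simp add: T_def convolve_add)
  moreover have "T (scal ?Q c f) = scal ?D c (T f)" for c f
    by (rule ext) (simp add: T_def scal_quasi_regular direct_sum_rep_def scal_Vrep convolve_scale fun_eq_iff)
  moreover have "T (act ?Q g f) = act ?D g (T f)" if "g \<in> carrier W" for g f
    using that by (intro ext) (simp add: T_def direct_sum_rep_def act_Vrep convolve_translate)
  ultimately show ?thesis
    using group_rep_quasi_regular D unfolding rep_iso_def by blast
qed

end

text \<open>The splitting \<open>B\<close> is arbitrary, so the result covers every realization of
  the \<open>V_kappa\<close>; \<open>blocks_exist\<close> with \<open>finite_characters\<close>
  shows that a choice is available.\<close>

theorem proposition4p5: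
  fixes A :: "('a, 'm) monoid_scheme"
    and n :: nat
    and B :: "(('a \<Rightarrow> complex) \<Rightarrow> nat) \<Rightarrow> ('a \<Rightarrow> complex) \<Rightarrow> nat set"
  assumes "comm_group A" and "finite (carrier A)" and "n \<ge> 2"
    and "\<And>\<kappa>. \<kappa> \<in> multiplicity_vectors n A \<Longrightarrow> blocks n A \<kappa> (B \<kappa>)"
  shows "(\<forall>\<kappa>\<in>multiplicity_vectors n A.
      \<exists>e. rep_basis (Vrep n A (B \<kappa>)) (multislice n A \<kappa>) e \<and>
        (\<forall>z\<in>multislice n A \<kappa>.
          (\<forall>x\<in>carrier (base_power n A).
             act (Vrep n A (B \<kappa>)) (of_base x) (e z) = scal (Vrep n A (B \<kappa>)) (pairing n z x) (e z)) \<and>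
          (\<forall>p. p permutes {1..n} \<longrightarrow>
             act (Vrep n A (B \<kappa>)) (of_perm n A p) (e z) = e (perm_act {1..n} p z)))) \<and>
    rep_iso (Wn n A) (quasi_regular n A)
      (direct_sum_rep (multiplicity_vectors n A) (\<lambda>\<kappa>. Vrep n A (B \<kappa>)))"
proof -
  interpret finite_abelian_wreath A n
    using assms(1,2) by (simp add: finite_abelian_wreath_def finite_abelian_wreath_axioms_def)
  show ?thesis
  proof (intro conjI ballI)
    fix \<kappa> assume "\<kappa> \<in> multiplicity_vectors n A"
    then interpret V: blocked_wreath A n \<kappa> "B \<kappa>"
      using assms(4) by unfold_locales
    show "\<exists>e. rep_basis (Vrep n A (B \<kappa>)) (multislice n A \<kappa>) e \<and>
        (\<forall>z\<in>multislice n A \<kappa>.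
          (\<forall>x\<in>carrier (base_power n A).
             act (Vrep n A (B \<kappa>)) (of_base x) (e z) = scal (Vrep n A (B \<kappa>)) (pairing n z x) (e z)) \<and>
          (\<forall>p. p permutes {1..n} \<longrightarrow>
             act (Vrep n A (B \<kappa>)) (of_perm n A p) (e z) = e (perm_act {1..n} p z)))"
      using V.orbit_vector_basis V.of_base_orbit_vector V.of_perm_orbit_vector by blast
  qed (rule quasi_regular_decomposition[OF assms(4)])
qed

end
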